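(* Let $I\subset\mathbb Z$, let $\mathcal H_+\subset\ell^2(\mathbb Z)$ be the closed span of $\{|n\rangle:n\in I\}$, and let $S$ be the self-adjoint operator on $\mathcal H_+$ that is diagonal with strictly positive eigenvalues, $S|n\rangle=S_n|n\rangle$ for $n\in I$. Let $f:\sigma(S)\to\mathbb R$ be a real Borel function, $\hbar>0$, and $H:=\hbar f(S)$ (possibly unbounded, with its natural domain from the spectral calculus). Put $\omega(n,m):=f(S_n)-f(S_m)$ for $n,m\in I$. Then for any bounded (or Hilbert–Schmidt) operator $X$ on $\mathcal H_+$ with matrix elements $A_{nm}:=\langle n|X|m\rangle$, the Heisenberg evolution $X(t):=e^{\frac i\hbar Ht}Xe^{-\frac i\hbar Ht}$ satisfies $$\langle n|X(t)|m\rangle=A_{nm}\,e^{\,i\,\omega(n,m)\,t}\qquad\text{for all }t\in\mathbb R,\ n,m\in I.$$ In particular, for all $n,m,k\in I$, $\omega(n,m)+\omega(m,k)=\omega(n,k)$, $\omega(n,n)=0$ and $\omega(n,m)=-\omega(m,n)$.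
   Context: $\{|n\rangle\}_{n\in\mathbb Z}$ is the canonical orthonormal basis of $\ell^2(\mathbb Z)$; the inner product is linear in the second entry. In the paper $S_n=S_0+n\Delta S$ with $\Delta S>0$, and $I$ is the set of indices with $S_n>0$. *)

theory Defs
  imports "HOL-Analysis.Analysis"
begin

section \<open>The Hilbert space of square-summable families\<close>

typedef 'a ell2 = "{\<psi> :: 'a \<Rightarrow> complex. (\<lambda>n. (cmod (\<psi> n))\<^sup>2) summable_on UNIV}"
  morphisms coord Abs_ell2
  by (rule exI[of _ "\<lambda>_. 0"]) simp

setup_lifting type_definition_ell2

lemma coord_eqI: "(\<And>n. coord \<psi> n = coord \<phi> n) \<Longrightarrow> \<psi> = \<phi>"
  by (metis coord_inject ext)

lemma coord_square_summable: "(\<lambda>n. (cmod (coord \<psi> n))\<^sup>2) summable_on A"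
proof -
  have "(\<lambda>n. (cmod (coord \<psi> n))\<^sup>2) summable_on UNIV"
    using coord[of \<psi>] by simp
  then show ?thesis
    by (rule summable_on_subset_banach) simp
qed

lemma square_summable_add:
  fixes x y :: "'a \<Rightarrow> complex"
  assumes "(\<lambda>n. (cmod (x n))\<^sup>2) summable_on UNIV" "(\<lambda>n. (cmod (y n))\<^sup>2) summable_on UNIV"
  shows "(\<lambda>n. (cmod (x n + y n))\<^sup>2) summable_on UNIV"
proof (rule summable_on_comparison_test)
  show "(\<lambda>n. 2 * (cmod (x n))\<^sup>2 + 2 * (cmod (y n))\<^sup>2) summable_on UNIV"
    by (intro summable_on_add summable_on_cmult_right assms)
  fix n
  have "(cmod (x n + y n))\<^sup>2 \<le> (cmod (x n) + cmod (y n))\<^sup>2"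
    by (intro power_mono norm_triangle_ineq) simp
  also have "\<dots> \<le> 2 * (cmod (x n))\<^sup>2 + 2 * (cmod (y n))\<^sup>2"
    using sum_squares_bound[of "cmod (x n)" "cmod (y n)"] by (simp add: power2_sum)
  finally show "(cmod (x n + y n))\<^sup>2 \<le> 2 * (cmod (x n))\<^sup>2 + 2 * (cmod (y n))\<^sup>2" .
qed simp

lemma square_summable_mult:
  fixes x :: "'a \<Rightarrow> complex"
  assumes "(\<lambda>n. (cmod (x n))\<^sup>2) summable_on UNIV"
  shows "(\<lambda>n. (cmod (c * x n))\<^sup>2) summable_on UNIV"
  using summable_on_cmult_right[OF assms, of "(cmod c)\<^sup>2"]
  by (simp add: norm_mult power_mult_distrib)

instantiation ell2 :: (type) ab_group_add
begin

lift_definition zero_ell2 :: "'a ell2" is "\<lambda>_. 0" by simp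
lift_definition plus_ell2 :: "'a ell2 \<Rightarrow> 'a ell2 \<Rightarrow> 'a ell2" is "\<lambda>\<psi> \<phi> n. \<psi> n + \<phi> n"
  by (rule square_summable_add)
lift_definition uminus_ell2 :: "'a ell2 \<Rightarrow> 'a ell2" is "\<lambda>\<psi> n. - \<psi> n" by simp
lift_definition minus_ell2 :: "'a ell2 \<Rightarrow> 'a ell2 \<Rightarrow> 'a ell2" is "\<lambda>\<psi> \<phi> n. \<psi> n - \<phi> n"
  using square_summable_add[of _ "\<lambda>n. - _ n"] by simp

instance
  by standard (transfer; simp add: algebra_simps)+

end

lift_definition scaleC :: "complex \<Rightarrow> 'a ell2 \<Rightarrow> 'a ell2" (infixr "*\<^sub>C" 75)
  is "\<lambda>c \<psi> n. c * \<psi> n"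
  by (rule square_summable_mult)

interpretation ell2_vs: vector_space "scaleC :: complex \<Rightarrow> 'a ell2 \<Rightarrow> 'a ell2"
  by standard (transfer; simp add: algebra_simps)+

definition cinner :: "'a ell2 \<Rightarrow> 'a ell2 \<Rightarrow> complex" where
  "cinner \<psi> \<phi> = (\<Sum>\<^sub>\<infinity>n. cnj (coord \<psi> n) * coord \<phi> n)"

lemma cinner_summable: "(\<lambda>n. cnj (coord \<psi> n) * coord \<phi> n) summable_on UNIV"
proof (rule Infinite_Sum.abs_summable_summable, rule Infinite_Sum.abs_summable_product)
  show "(\<lambda>n. norm (cnj (coord \<psi> n) * cnj (coord \<psi> n))) summable_on UNIV"
    "(\<lambda>n. norm (coord \<phi> n * coord \<phi> n)) summable_on UNIV"
    using coord_square_summable[of \<psi> UNIV] coord_square_summable[of \<phi> UNIV]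
    by (simp_all add: norm_mult power2_eq_square)
qed

lemma cinner_commute: "cinner \<phi> \<psi> = cnj (cinner \<psi> \<phi>)"
  unfolding cinner_def by (subst infsum_cnj[symmetric]) (simp add: mult.commute)

lemma cinner_add_left: "cinner (\<psi> + \<xi>) \<phi> = cinner \<psi> \<phi> + cinner \<xi> \<phi>"
  unfolding cinner_def
  by (subst infsum_add[symmetric]) (simp_all add: cinner_summable plus_ell2.rep_eq distrib_right)

lemma cinner_scaleC_left: "cinner (c *\<^sub>C \<psi>) \<phi> = cnj c * cinner \<psi> \<phi>"
  unfolding cinner_def
  by (subst infsum_cmult_right'[symmetric]) (simp add: scaleC.rep_eq algebra_simps)

lemma cinner_self: "cinner \<psi> \<psi> = complex_of_real (\<Sum>\<^sub>\<infinity>n. (cmod (coord \<psi> n))\<^sup>2)"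
proof -
  have "cinner \<psi> \<psi> = (\<Sum>\<^sub>\<infinity>n. complex_of_real ((cmod (coord \<psi> n))\<^sup>2))"
    unfolding cinner_def by (intro infsum_cong) (simp only: complex_norm_square mult.commute)
  also have "\<dots> = complex_of_real (\<Sum>\<^sub>\<infinity>n. (cmod (coord \<psi> n))\<^sup>2)"
    by (rule infsumI[OF has_sum_bounded_linear[OF bounded_linear_of_real
          has_sum_infsum[OF coord_square_summable]]])
  finally show ?thesis .
qed

lemma cinner_self_eq_0_iff: "Re (cinner \<psi> \<psi>) = 0 \<longleftrightarrow> \<psi> = 0"
proof
  assume "Re (cinner \<psi> \<psi>) = 0"
  then have "(\<Sum>\<^sub>\<infinity>n. (cmod (coord \<psi> n))\<^sup>2) \<le> 0" by (simp add: cinner_self)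
  then have "(cmod (coord \<psi> n))\<^sup>2 = 0" for n
    by (rule nonneg_infsum_le_0D[OF _ coord_square_summable]) auto
  then show "\<psi> = 0" by (intro coord_eqI) (simp add: zero_ell2.rep_eq)
qed (simp add: cinner_def zero_ell2.rep_eq)

text \<open>The real inner product is the real part of the complex one; this makes the norm, the
  topology and the notion of closure those of the complex Hilbert space.\<close>

instantiation ell2 :: (type) real_inner
begin

definition scaleR_ell2 :: "real \<Rightarrow> 'a ell2 \<Rightarrow> 'a ell2" where
  "scaleR_ell2 r \<psi> = complex_of_real r *\<^sub>C \<psi>"
definition inner_ell2 :: "'a ell2 \<Rightarrow> 'a ell2 \<Rightarrow> real" where
  "inner_ell2 \<psi> \<phi> = Re (cinner \<psi> \<phi>)"
definition norm_ell2 :: "'a ell2 \<Rightarrow> real" where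
  "norm_ell2 \<psi> = sqrt (inner \<psi> \<psi>)"
definition dist_ell2 :: "'a ell2 \<Rightarrow> 'a ell2 \<Rightarrow> real" where
  "dist_ell2 \<psi> \<phi> = norm (\<psi> - \<phi>)"
definition sgn_ell2 :: "'a ell2 \<Rightarrow> 'a ell2" where
  "sgn_ell2 \<psi> = inverse (norm \<psi>) *\<^sub>R \<psi>"
definition uniformity_ell2 :: "('a ell2 \<times> 'a ell2) filter" where
  "uniformity_ell2 = (INF e\<in>{0<..}. principal {(x, y). dist x y < e})"
definition open_ell2 :: "'a ell2 set \<Rightarrow> bool" where
  "open_ell2 U \<longleftrightarrow> (\<forall>x\<in>U. \<forall>\<^sub>F (x', y) in uniformity. x' = x \<longrightarrow> y \<in> U)"

instance
proof
  fix \<psi> \<phi> \<xi> :: "'a ell2" and r q :: real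
  show "r *\<^sub>R (\<psi> + \<phi>) = r *\<^sub>R \<psi> + r *\<^sub>R \<phi>" "(r + q) *\<^sub>R \<psi> = r *\<^sub>R \<psi> + q *\<^sub>R \<psi>"
    "r *\<^sub>R q *\<^sub>R \<psi> = (r * q) *\<^sub>R \<psi>" "1 *\<^sub>R \<psi> = \<psi>"
    by (simp_all add: scaleR_ell2_def ell2_vs.scale_right_distrib ell2_vs.scale_left_distrib)
  show "inner \<psi> \<phi> = inner \<phi> \<psi>"
    by (simp add: inner_ell2_def cinner_commute[of \<psi> \<phi>])
  show "inner (\<psi> + \<phi>) \<xi> = inner \<psi> \<xi> + inner \<phi> \<xi>" "inner (r *\<^sub>R \<psi>) \<phi> = r * inner \<psi> \<phi>"
    by (simp_all add: inner_ell2_def scaleR_ell2_def cinner_add_left cinner_scaleC_left)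
  show "0 \<le> inner \<psi> \<psi>"
    by (simp add: inner_ell2_def cinner_self infsum_nonneg)
  show "inner \<psi> \<psi> = 0 \<longleftrightarrow> \<psi> = 0"
    by (simp add: inner_ell2_def cinner_self_eq_0_iff)
qed (fact norm_ell2_def dist_ell2_def sgn_ell2_def uniformity_ell2_def open_ell2_def)+

end

lift_definition ket :: "'a \<Rightarrow> 'a ell2" is "\<lambda>n m. if m = n then 1 else 0"
proof -
  fix n :: 'a
  have "(\<lambda>m. (cmod (if m = n then 1 else 0))\<^sup>2) summable_on {n}" by simp
  then show "(\<lambda>m. (cmod (if m = n then 1 else 0))\<^sup>2) summable_on UNIV"
    by (subst summable_on_cong_neutral[where T = "{n}" and g = "\<lambda>m. (cmod (if m = n then 1 else 0))\<^sup>2"]) auto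
qed

section \<open>Operators on a closed subspace\<close>

text \<open>A possibly unbounded operator is a partial function, defined exactly on its domain
  \<^term>\<open>dom A\<close>; equality of operators therefore includes equality of domains, and
  \<open>\<circ>\<^sub>m\<close> is the product of operators with its natural domain. The argument \<open>H\<close> below is the
  closed subspace that serves as the ambient Hilbert space.\<close>

type_synonym 'a operator = "'a ell2 \<rightharpoonup> 'a ell2"

definition linear_operator :: "'a ell2 set \<Rightarrow> 'a operator \<Rightarrow> bool" where
  "linear_operator H A \<longleftrightarrow>
     ell2_vs.subspace (dom A) \<and> dom A \<subseteq> H \<and> ran A \<subseteq> H \<and>
     (\<forall>\<psi>\<in>dom A. \<forall>\<phi>\<in>dom A. the (A (\<psi> + \<phi>)) = the (A \<psi>) + the (A \<phi>)) \<and>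
     (\<forall>c. \<forall>\<psi>\<in>dom A. the (A (c *\<^sub>C \<psi>)) = c *\<^sub>C the (A \<psi>))"

definition bounded_operator :: "'a ell2 set \<Rightarrow> 'a operator \<Rightarrow> bool" where
  "bounded_operator H A \<longleftrightarrow>
     linear_operator H A \<and> dom A = H \<and> (\<exists>C. \<forall>\<psi>\<in>H. norm (the (A \<psi>)) \<le> C * norm \<psi>)"

definition hilbert_schmidt :: "'a ell2 set \<Rightarrow> 'a operator \<Rightarrow> bool" where
  "hilbert_schmidt H A \<longleftrightarrow>
     bounded_operator H A \<and>
     (\<exists>B\<subseteq>H. (\<forall>\<psi>\<in>B. \<forall>\<phi>\<in>B. cinner \<psi> \<phi> = (if \<psi> = \<phi> then 1 else 0)) \<and>
       closure (ell2_vs.span B) = H \<and> (\<lambda>\<psi>. (norm (the (A \<psi>)))\<^sup>2) summable_on B)"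

text \<open>The value of the adjoint is unique, hence \<open>THE\<close> is meaningful, when \<open>A\<close> is densely
  defined in \<open>H\<close>.\<close>

definition adjoint_operator :: "'a ell2 set \<Rightarrow> 'a operator \<Rightarrow> 'a operator" where
  "adjoint_operator H A = (\<lambda>\<psi>.
     if \<psi> \<in> H \<and> (\<exists>\<phi>\<in>H. \<forall>\<xi>\<in>dom A. cinner (the (A \<xi>)) \<psi> = cinner \<xi> \<phi>)
     then Some (THE \<phi>. \<phi> \<in> H \<and> (\<forall>\<xi>\<in>dom A. cinner (the (A \<xi>)) \<psi> = cinner \<xi> \<phi>))
     else None)"

definition self_adjoint :: "'a ell2 set \<Rightarrow> 'a operator \<Rightarrow> bool" where
  "self_adjoint H A \<longleftrightarrow> linear_operator H A \<and> H \<subseteq> closure (dom A) \<and> adjoint_operator H A = A"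

definition scale_operator :: "complex \<Rightarrow> 'a operator \<Rightarrow> 'a operator" where
  "scale_operator c A = (\<lambda>\<psi>. map_option (\<lambda>\<phi>. c *\<^sub>C \<phi>) (A \<psi>))"

definition shift_operator :: "'a operator \<Rightarrow> complex \<Rightarrow> 'a operator" where
  "shift_operator A z = (\<lambda>\<psi>. map_option (\<lambda>\<phi>. \<phi> - z *\<^sub>C \<psi>) (A \<psi>))"

definition spectrum :: "'a ell2 set \<Rightarrow> 'a operator \<Rightarrow> complex set" where
  "spectrum H A = {z. \<not> (\<exists>R. bounded_operator H R \<and>
     R \<circ>\<^sub>m shift_operator A z = Some |` dom A \<and> shift_operator A z \<circ>\<^sub>m R = Some |` H)}"

section \<open>Spectral calculus\<close>

definition orthogonal_projection :: "'a ell2 set \<Rightarrow> 'a operator \<Rightarrow> bool" where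
  "orthogonal_projection H P \<longleftrightarrow>
     bounded_operator H P \<and> P \<circ>\<^sub>m P = P \<and> adjoint_operator H P = P"

definition projection_valued_measure :: "'a ell2 set \<Rightarrow> (real set \<Rightarrow> 'a operator) \<Rightarrow> bool" where
  "projection_valued_measure H E \<longleftrightarrow>
     (\<forall>B\<in>sets borel. orthogonal_projection H (E B)) \<and> E UNIV = Some |` H \<and>
     (\<forall>B :: nat \<Rightarrow> real set. range B \<subseteq> sets borel \<longrightarrow> disjoint_family B \<longrightarrow>
        (\<forall>\<psi>\<in>H. (\<lambda>k. the (E (B k) \<psi>)) sums the (E (\<Union>k. B k) \<psi>)))"

definition scalar_measure :: "(real set \<Rightarrow> 'a operator) \<Rightarrow> 'a ell2 \<Rightarrow> real measure" where
  "scalar_measure E \<psi> =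
     measure_of UNIV (sets borel) (\<lambda>B. ennreal (Re (cinner \<psi> (the (E B \<psi>)))))"

text \<open>\<open>T\<close> is the integral of \<open>g\<close> with respect to \<open>E\<close>, with its natural (maximal) domain. On that
  dense domain the quadratic form determines \<open>T\<close>, by polarization.\<close>

definition is_spectral_integral ::
    "'a ell2 set \<Rightarrow> (real set \<Rightarrow> 'a operator) \<Rightarrow> (real \<Rightarrow> complex) \<Rightarrow> 'a operator \<Rightarrow> bool" where
  "is_spectral_integral H E g T \<longleftrightarrow>
     linear_operator H T \<and>
     dom T = {\<psi>\<in>H. (\<integral>\<^sup>+x. ennreal ((cmod (g x))\<^sup>2) \<partial>scalar_measure E \<psi>) < \<infinity>} \<and>
     (\<forall>\<psi>\<in>dom T. cinner \<psi> (the (T \<psi>)) = (\<integral>x. g x \<partial>scalar_measure E \<psi>))"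

definition spectral_measure_of ::
    "'a ell2 set \<Rightarrow> 'a operator \<Rightarrow> (real set \<Rightarrow> 'a operator) \<Rightarrow> bool" where
  "spectral_measure_of H A E \<longleftrightarrow>
     projection_valued_measure H E \<and> is_spectral_integral H E complex_of_real A"

text \<open>The spectral measure of a self-adjoint operator is unique on Borel sets and its value on
  other sets is never used, so the choice made by \<open>SOME\<close> is immaterial. It is carried by the
  spectrum, and only the values of \<open>g\<close> on the spectrum enter.\<close>

definition borel_calculus :: "'a ell2 set \<Rightarrow> 'a operator \<Rightarrow> (real \<Rightarrow> complex) \<Rightarrow> 'a operator" where
  "borel_calculus H A g =
     (THE T. is_spectral_integral H (SOME E. spectral_measure_of H A E)
        (\<lambda>x. if complex_of_real x \<in> spectrum H A then g x else 0) T)"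

section \<open>Heisenberg evolution\<close>

definition propagator :: "'a ell2 set \<Rightarrow> real \<Rightarrow> 'a operator \<Rightarrow> real \<Rightarrow> 'a operator" where
  "propagator H hbar Ham t =
     borel_calculus H Ham (\<lambda>x. exp (\<i> / complex_of_real hbar * complex_of_real x * complex_of_real t))"

definition heisenberg_evolution ::
    "'a ell2 set \<Rightarrow> real \<Rightarrow> 'a operator \<Rightarrow> 'a operator \<Rightarrow> real \<Rightarrow> 'a operator" where
  "heisenberg_evolution H hbar Ham X t =
     propagator H hbar Ham t \<circ>\<^sub>m X \<circ>\<^sub>m propagator H hbar Ham (- t)"

definition matrix_element :: "'a \<Rightarrow> 'a operator \<Rightarrow> 'a \<Rightarrow> complex" where
  "matrix_element n X m = cinner (ket n) (the (X (ket m)))"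

end

theory Submission
  imports Defs
begin

text \<open>
  A self-adjoint operator that is diagonal on the kets is the maximal diagonal operator, since its
  adjoint is determined by its values on the kets. The Borel calculus of a maximal diagonal
  operator with real entries \<open>s n\<close> applies \<open>g\<close> to the entries, so the Hamiltonian is diagonal
  with entries \<open>hbar * f (s n)\<close>, the propagator multiplies the \<open>n\<close>-th coordinate by a phase, and the
  matrix element of the evolved operator picks up the product of two phases.

  As the calculus is defined by an arbitrary choice of spectral measure \<open>E\<close>, uniqueness is needed:
  if \<open>\<psi>\<close> is an eigenvector with eigenvalue \<open>l\<close> and \<open>\<phi> = E {l<..} \<psi>\<close>, then the integral of
  \<open>x - l\<close> against the scalar measure of \<open>\<phi>\<close> vanishes, so \<open>\<phi> = 0\<close>; likewise on the other side.
  Hence \<open>E\<close> is determined on the kets, and by symmetry of \<open>E B\<close> everywhere.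
\<close>

section \<open>Coordinates and inner product\<close>

declare zero_ell2.rep_eq [simp] plus_ell2.rep_eq [simp] minus_ell2.rep_eq [simp]
  uminus_ell2.rep_eq [simp] scaleC.rep_eq [simp]

lemma coord_ket [simp]: "coord (ket n) m = (if m = n then 1 else 0)"
  by (simp add: ket.rep_eq)

lemma coord_Abs_ell2:
  assumes "(\<lambda>n. (cmod (f n))\<^sup>2) summable_on UNIV"
  shows "coord (Abs_ell2 f) = f"
  using assms by (simp add: Abs_ell2_inverse)

lemma coord_sum [simp]: "coord (\<Sum>x\<in>F. g x) n = (\<Sum>x\<in>F. coord (g x) n)"
  by (induction F rule: infinite_finite_induct) auto

lemma cinner_add_right: "cinner \<phi> (\<psi> + \<xi>) = cinner \<phi> \<psi> + cinner \<phi> \<xi>"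
  by (metis cinner_add_left cinner_commute complex_cnj_add)

lemma cinner_scaleC_right: "cinner \<phi> (c *\<^sub>C \<psi>) = c * cinner \<phi> \<psi>"
  by (metis cinner_scaleC_left cinner_commute complex_cnj_mult complex_cnj_cnj)

lemma cinner_zero [simp]: "cinner 0 \<psi> = 0" "cinner \<psi> 0 = 0"
  by (simp_all add: cinner_def)

lemma cinner_minus_left: "cinner (- \<psi>) \<phi> = - cinner \<psi> \<phi>"
  by (metis add.right_inverse cinner_add_left cinner_zero(1) eq_neg_iff_add_eq_0 add.commute)

lemma cinner_minus_right: "cinner \<phi> (- \<psi>) = - cinner \<phi> \<psi>"
  by (metis cinner_commute cinner_minus_left complex_cnj_minus)

lemma cinner_diff_right: "cinner \<phi> (\<psi> - \<xi>) = cinner \<phi> \<psi> - cinner \<phi> \<xi>"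
  using cinner_add_right[of \<phi> \<psi> "- \<xi>"] by (simp add: cinner_minus_right)

lemma cinner_ket_left: "cinner (ket n) \<psi> = coord \<psi> n"
proof -
  have "cinner (ket n) \<psi> = (\<Sum>\<^sub>\<infinity>m\<in>{n}. cnj (coord (ket n) m) * coord \<psi> m)"
    unfolding cinner_def by (rule infsum_cong_neutral) auto
  then show ?thesis by simp
qed

lemma norm_square_ell2: "(norm \<psi>)\<^sup>2 = (\<Sum>\<^sub>\<infinity>n. (cmod (coord \<psi> n))\<^sup>2)" for \<psi> :: "'a ell2"
  by (simp add: power2_norm_eq_inner inner_ell2_def cinner_self)

lemma cinner_self_norm: "cinner \<psi> \<psi> = complex_of_real ((norm \<psi>)\<^sup>2)"
  by (simp add: norm_square_ell2 cinner_self)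

lemma norm_scaleC: "norm (c *\<^sub>C \<psi>) = cmod c * norm \<psi>"
proof (rule power2_eq_imp_eq)
  show "(norm (c *\<^sub>C \<psi>))\<^sup>2 = (cmod c * norm \<psi>)\<^sup>2"
    by (simp add: norm_square_ell2 norm_mult power_mult_distrib infsum_cmult_right')
qed auto

lemma norm_ket [simp]: "norm (ket n) = 1"
proof -
  have "(norm (ket n))\<^sup>2 = 1"
    using cinner_self_norm[of "ket n"] by (simp add: cinner_ket_left flip: of_real_power)
  then show ?thesis by (simp add: power2_eq_1_iff) (metis norm_ge_zero not_one_le_zero neg_0_le_iff_le)
qed

lemma cmod_coord_le_norm: "cmod (coord \<psi> n) \<le> norm \<psi>"
proof (rule power2_le_imp_le)
  have "(\<Sum>m\<in>{n}. (cmod (coord \<psi> m))\<^sup>2) \<le> (\<Sum>\<^sub>\<infinity>m. (cmod (coord \<psi> m))\<^sup>2)"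
    by (rule finite_sum_le_infsum[OF coord_square_summable]) auto
  then show "(cmod (coord \<psi> n))\<^sup>2 \<le> (norm \<psi>)\<^sup>2"
    by (simp add: norm_square_ell2)
qed simp

text \<open>Continuity of the coordinates, with norm bound 1; it is what makes
  \<open>supported I\<close> closed.\<close>

lemma bounded_linear_coord: "bounded_linear (\<lambda>\<psi>. coord \<psi> n)"
  by (rule bounded_linear_intro[where K = 1])
     (auto simp: scaleR_ell2_def scaleR_conv_of_real cmod_coord_le_norm)

section \<open>Vectors supported in an index set\<close>

text \<open>A concrete form of the closed span of the kets over \<open>I\<close>, identified with it
  in \<open>closure_span_ket\<close>; membership becomes a condition on coordinates.\<close>

definition supported :: "'a set \<Rightarrow> 'a ell2 set" where
  "supported I = {\<psi>. \<forall>n. n \<notin> I \<longrightarrow> coord \<psi> n = 0}"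

lemma subspace_supported: "ell2_vs.subspace (supported I)"
  by (auto simp: ell2_vs.subspace_def supported_def)

lemma ket_in_supported [simp]: "ket n \<in> supported I \<longleftrightarrow> n \<in> I"
  by (auto simp: supported_def)

lemma supported_eqI:
  assumes "\<psi> \<in> supported I" "\<phi> \<in> supported I" "\<And>n. n \<in> I \<Longrightarrow> coord \<psi> n = coord \<phi> n"
  shows "\<psi> = \<phi>"
proof (rule coord_eqI)
  show "coord \<psi> n = coord \<phi> n" for n
    using assms by (cases "n \<in> I") (auto simp: supported_def)
qed

lemma closed_supported: "closed (supported I)"
proof -
  have "supported I = (\<Inter>n\<in>-I. (\<lambda>\<psi>. coord \<psi> n) -` {0})"
    by (auto simp: supported_def)
  moreover have "closed ((\<lambda>\<psi>. coord \<psi> n) -` {0})" for n :: 'a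
    by (intro continuous_closed_vimage closed_singleton
        linear_continuous_at[OF bounded_linear_coord])
  ultimately show ?thesis by auto
qed

text \<open>Finite truncations approximate: the squared distance from \<psi> to its truncation is a
  tail of the convergent sum of squared coordinates.\<close>

lemma supported_subset_closure: "supported I \<subseteq> closure (ell2_vs.span (ket ` I))"
proof
  fix \<psi> :: "'a ell2" assume \<psi>: "\<psi> \<in> supported I"
  show "\<psi> \<in> closure (ell2_vs.span (ket ` I))"
    unfolding closure_approachable
  proof (intro allI impI)
    fix e :: real assume "e > 0"
    let ?f = "\<lambda>n. (cmod (coord \<psi> n))\<^sup>2"
    have "(sum ?f \<longlongrightarrow> infsum ?f UNIV) (finite_subsets_at_top UNIV)"
      by (rule infsum_tendsto[OF coord_square_summable])
    from tendstoD[OF this, of "e\<^sup>2"] \<open>e > 0\<close> obtain F where F: "finite F"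
      and d: "dist (sum ?f F) (infsum ?f UNIV) < e\<^sup>2"
      by (auto simp: eventually_finite_subsets_at_top)
    define \<zeta> where "\<zeta> = (\<Sum>n\<in>F. coord \<psi> n *\<^sub>C ket n)"
    have c: "coord \<zeta> m = (if m \<in> F then coord \<psi> m else 0)" for m
      using F by (simp add: \<zeta>_def if_distrib sum.delta cong: if_cong)
    have "(norm (\<zeta> - \<psi>))\<^sup>2 = infsum ?f (UNIV - F)"
      unfolding norm_square_ell2 by (rule infsum_cong_neutral) (auto simp: c)
    also have "\<dots> = infsum ?f UNIV - infsum ?f F"
      by (rule infsum_Diff) (auto intro: coord_square_summable)
    also have "\<dots> < e\<^sup>2"
      using d F by (auto simp: dist_real_def abs_if split: if_splits)
    finally have "dist \<zeta> \<psi> < e"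
      unfolding dist_norm using \<open>e > 0\<close> by (meson less_imp_le power2_less_imp_less)
    moreover have "\<zeta> \<in> ell2_vs.span (ket ` I)"
      unfolding \<zeta>_def
    proof (rule ell2_vs.span_sum)
      \<comment> \<open>\<open>F\<close> may leave \<open>I\<close>, but there the coefficient of
        \<psi> is 0.\<close>
      fix n assume "n \<in> F"
      show "coord \<psi> n *\<^sub>C ket n \<in> ell2_vs.span (ket ` I)"
      proof (cases "n \<in> I")
        case True
        then show ?thesis by (intro ell2_vs.span_scale ell2_vs.span_base) auto
      next
        case False
        then show ?thesis using \<psi> by (simp add: supported_def ell2_vs.span_zero)
      qed
    qed
    ultimately show "\<exists>y\<in>ell2_vs.span (ket ` I). dist y \<psi> < e" by blast
  qed
qed

lemma closure_span_ket: "closure (ell2_vs.span (ket ` I)) = supported I"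
proof (rule antisym[OF _ supported_subset_closure])
  show "closure (ell2_vs.span (ket ` I)) \<subseteq> supported I"
    by (intro closure_minimal closed_supported ell2_vs.span_minimal subspace_supported) auto
qed

section \<open>Maximal diagonal operators\<close>

definition diag_op :: "'a set \<Rightarrow> ('a \<Rightarrow> complex) \<Rightarrow> 'a operator" where
  "diag_op I a = (\<lambda>\<psi>.
     if \<psi> \<in> supported I \<and> (\<lambda>n. (cmod (a n * coord \<psi> n))\<^sup>2) summable_on UNIV
     then Some (Abs_ell2 (\<lambda>n. a n * coord \<psi> n)) else None)"

text \<open>Operators are compared through their graphs, which treats domains and values at
  once.\<close>

lemma operator_eqI:
  assumes "\<And>\<psi> \<phi>. A \<psi> = Some \<phi> \<longleftrightarrow> B \<psi> = Some \<phi>"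
  shows "A = B"
proof
  show "A \<psi> = B \<psi>" for \<psi>
    using assms[of \<psi>] by (cases "A \<psi>") force+
qed

lemma dom_diag_op:
  "dom (diag_op I a) = {\<psi> \<in> supported I. (\<lambda>n. (cmod (a n * coord \<psi> n))\<^sup>2) summable_on UNIV}"
  by (auto simp: diag_op_def split: if_splits)

text \<open>Summability disappears from the graph description: a vector \<phi> with these
  coordinates is square-summable by its type, and this is exactly the domain condition.\<close>

lemma diag_op_eq_Some_iff:
  "diag_op I a \<psi> = Some \<phi> \<longleftrightarrow> \<psi> \<in> supported I \<and> (\<forall>n. coord \<phi> n = a n * coord \<psi> n)"
proof
  assume "diag_op I a \<psi> = Some \<phi>"
  then show "\<psi> \<in> supported I \<and> (\<forall>n. coord \<phi> n = a n * coord \<psi> n)"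
    by (auto simp: diag_op_def coord_Abs_ell2 split: if_splits)
next
  assume *: "\<psi> \<in> supported I \<and> (\<forall>n. coord \<phi> n = a n * coord \<psi> n)"
  then have **: "(\<lambda>n. (cmod (a n * coord \<psi> n))\<^sup>2) summable_on UNIV"
    using coord_square_summable[of \<phi> UNIV] by simp
  then have "Abs_ell2 (\<lambda>n. a n * coord \<psi> n) = \<phi>"
    using * by (intro coord_eqI) (simp add: coord_Abs_ell2)
  with * ** show "diag_op I a \<psi> = Some \<phi>" by (simp add: diag_op_def)
qed

lemma coord_diag_op: "\<psi> \<in> dom (diag_op I a) \<Longrightarrow> coord (the (diag_op I a \<psi>)) n = a n * coord \<psi> n"
  using diag_op_eq_Some_iff by fastforce

lemma diag_op_cong:
  assumes "\<And>n. n \<in> I \<Longrightarrow> a n = b n"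
  shows "diag_op I a = diag_op I b"
proof (rule ext)
  fix \<psi>
  have eq: "a n * coord \<psi> n = b n * coord \<psi> n" if "\<psi> \<in> supported I" for n
    using that assms by (cases "n \<in> I") (auto simp: supported_def)
  show "diag_op I a \<psi> = diag_op I b \<psi>"
    unfolding diag_op_def by (cases "\<psi> \<in> supported I") (simp_all only: eq simp_thms if_False)
qed

section \<open>Linearity, boundedness and products of diagonal operators\<close>

lemma linear_operator_diag_op: "linear_operator (supported I) (diag_op I a)"
proof -
  have ran: "ran (diag_op I a) \<subseteq> supported I"
    by (auto simp: ran_def diag_op_eq_Some_iff supported_def)
  have domD_supported: "\<psi> \<in> supported I" if "\<psi> \<in> dom (diag_op I a)" for \<psi>
    using that by (simp add: dom_diag_op)
  have add: "diag_op I a (\<psi> + \<phi>) = Some (the (diag_op I a \<psi>) + the (diag_op I a \<phi>))"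
    if "\<psi> \<in> dom (diag_op I a)" "\<phi> \<in> dom (diag_op I a)" for \<psi> \<phi>
    using that subspace_supported[of I] domD_supported
    by (simp add: diag_op_eq_Some_iff ell2_vs.subspace_def coord_diag_op distrib_left)
  have scale: "diag_op I a (c *\<^sub>C \<psi>) = Some (c *\<^sub>C the (diag_op I a \<psi>))"
    if "\<psi> \<in> dom (diag_op I a)" for \<psi> c
    using that subspace_supported[of I] domD_supported
    by (simp add: diag_op_eq_Some_iff ell2_vs.subspace_def coord_diag_op)
  have "ell2_vs.subspace (dom (diag_op I a))"
    unfolding ell2_vs.subspace_def using add scale
    by (auto simp: dom_def[of "diag_op I a"]) (auto simp: dom_diag_op supported_def diag_op_def)
  with ran add scale show ?thesis
    by (auto simp: linear_operator_def dom_diag_op)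
qed

text \<open>Coordinatewise comparison. \<open>max 0 C\<close> is nonnegative even when
  \<open>I\<close> is empty, as the passage between squares and norms requires.\<close>

lemma diag_op_bounded:
  assumes C: "\<And>n. n \<in> I \<Longrightarrow> cmod (a n) \<le> C" and \<psi>: "\<psi> \<in> supported I"
  shows "\<psi> \<in> dom (diag_op I a)" "norm (the (diag_op I a \<psi>)) \<le> max 0 C * norm \<psi>"
proof -
  have le: "(cmod (a n * coord \<psi> n))\<^sup>2 \<le> (max 0 C)\<^sup>2 * (cmod (coord \<psi> n))\<^sup>2" for n
  proof (cases "n \<in> I")
    case True
    then have "cmod (a n) * cmod (coord \<psi> n) \<le> max 0 C * cmod (coord \<psi> n)"
      using C[OF True] by (intro mult_right_mono) auto
    then show ?thesis by (simp add: norm_mult power_mono flip: power_mult_distrib)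
  qed (use \<psi> in \<open>simp add: supported_def\<close>)
  have s: "(\<lambda>n. (max 0 C)\<^sup>2 * (cmod (coord \<psi> n))\<^sup>2) summable_on UNIV"
    by (intro summable_on_cmult_right coord_square_summable)
  have "(\<lambda>n. (cmod (a n * coord \<psi> n))\<^sup>2) summable_on UNIV"
    by (rule summable_on_comparison_test[OF s]) (auto intro: le)
  then show dom: "\<psi> \<in> dom (diag_op I a)" using \<psi> by (simp add: dom_diag_op)
  have "(norm (the (diag_op I a \<psi>)))\<^sup>2 \<le> (\<Sum>\<^sub>\<infinity>n. (max 0 C)\<^sup>2 * (cmod (coord \<psi> n))\<^sup>2)"
    unfolding norm_square_ell2
    by (rule infsum_mono[OF coord_square_summable s]) (use le in \<open>simp add: coord_diag_op[OF dom]\<close>)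
  also have "\<dots> = (max 0 C * norm \<psi>)\<^sup>2"
    by (simp add: infsum_cmult_right' norm_square_ell2 power_mult_distrib)
  finally show "norm (the (diag_op I a \<psi>)) \<le> max 0 C * norm \<psi>"
    by (rule power2_le_imp_le) auto
qed

lemma bounded_operator_diag_op:
  assumes C: "\<And>n. n \<in> I \<Longrightarrow> cmod (a n) \<le> C"
  shows "bounded_operator (supported I) (diag_op I a)"
  unfolding bounded_operator_def
proof (intro conjI linear_operator_diag_op)
  show "dom (diag_op I a) = supported I"
    using diag_op_bounded(1)[of I a C] C by (auto simp: dom_diag_op)
  show "\<exists>K. \<forall>\<psi>\<in>supported I. norm (the (diag_op I a \<psi>)) \<le> K * norm \<psi>"
    using diag_op_bounded(2)[of I a C] C by blast
qed

lemma diag_op_ket: "n \<in> I \<Longrightarrow> diag_op I a (ket n) = Some (a n *\<^sub>C ket n)"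
  by (simp add: diag_op_eq_Some_iff)

lemma ket_in_dom_diag_op: "n \<in> I \<Longrightarrow> ket n \<in> dom (diag_op I a)"
  by (simp add: domIff diag_op_ket)

text \<open>The domain of the inner factor has to appear: with \<open>a\<close> inverse to an
  unbounded \<open>b\<close>, the product \<open>a n * b n * coord \<psi> n\<close> is
  square-summable for vectors outside the domain of \<open>diag_op I b\<close>.\<close>

lemma diag_op_comp_Some_iff:
  "(diag_op I a \<circ>\<^sub>m diag_op I b) \<psi> = Some \<phi> \<longleftrightarrow>
     \<psi> \<in> dom (diag_op I b) \<and> (\<forall>n. coord \<phi> n = a n * b n * coord \<psi> n)"
proof -
  have "(diag_op I a \<circ>\<^sub>m diag_op I b) \<psi> = Some \<phi> \<longleftrightarrow>
      (\<exists>\<zeta>. diag_op I b \<psi> = Some \<zeta> \<and> diag_op I a \<zeta> = Some \<phi>)"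
    by (auto simp: map_comp_def split: option.splits)
  then show ?thesis
    by (auto simp: dom_def diag_op_eq_Some_iff supported_def algebra_simps)
qed

section \<open>Adjoints and self-adjointness of diagonal operators\<close>

lemma adjoint_eq_SomeI:
  assumes kets: "ket ` I \<subseteq> dom A" and "\<psi> \<in> supported I" "\<phi> \<in> supported I"
    and adj: "\<And>\<xi>. \<xi> \<in> dom A \<Longrightarrow> cinner (the (A \<xi>)) \<psi> = cinner \<xi> \<phi>"
  shows "adjoint_operator (supported I) A \<psi> = Some \<phi>"
proof -
  \<comment> \<open>Testing against a ket reads off a coordinate, so having the kets in the domain
    plays the part of density in making the adjoint single-valued.\<close>
  have "(THE \<phi>. \<phi> \<in> supported I \<and> (\<forall>\<xi>\<in>dom A. cinner (the (A \<xi>)) \<psi> = cinner \<xi> \<phi>)) = \<phi>"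
  proof (rule the_equality)
    fix \<phi>' assume *: "\<phi>' \<in> supported I \<and> (\<forall>\<xi>\<in>dom A. cinner (the (A \<xi>)) \<psi> = cinner \<xi> \<phi>')"
    have "coord \<phi>' n = coord \<phi> n" if "n \<in> I" for n
    proof -
      have "ket n \<in> dom A" using that kets by auto
      then have "cinner (ket n) \<phi>' = cinner (ket n) \<phi>" using * adj by simp
      then show ?thesis by (simp add: cinner_ket_left)
    qed
    then show "\<phi>' = \<phi>" using * assms(3) by (intro supported_eqI[of _ I]) auto
  qed (use assms in auto)
  then show ?thesis using assms(2-4) by (auto simp: adjoint_operator_def)
qed

lemma adjoint_eq_SomeD:
  assumes kets: "ket ` I \<subseteq> dom A" and "adjoint_operator (supported I) A \<psi> = Some \<phi>"
  shows "\<psi> \<in> supported I" "\<phi> \<in> supported I"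
    "\<And>\<xi>. \<xi> \<in> dom A \<Longrightarrow> cinner (the (A \<xi>)) \<psi> = cinner \<xi> \<phi>"
proof -
  from assms(2) obtain \<phi>' where *: "\<psi> \<in> supported I" "\<phi>' \<in> supported I"
     "\<forall>\<xi>\<in>dom A. cinner (the (A \<xi>)) \<psi> = cinner \<xi> \<phi>'"
    by (auto simp: adjoint_operator_def split: if_splits)
  then have "adjoint_operator (supported I) A \<psi> = Some \<phi>'"
    by (intro adjoint_eq_SomeI[OF kets]) auto
  with assms(2) have "\<phi>' = \<phi>" by simp
  with * show "\<psi> \<in> supported I" "\<phi> \<in> supported I"
    "\<And>\<xi>. \<xi> \<in> dom A \<Longrightarrow> cinner (the (A \<xi>)) \<psi> = cinner \<xi> \<phi>" by auto
qed

text \<open>Testing on kets forces the coordinates of the adjoint's value; conversely the multiplier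
  moves across the inner product term by term.\<close>

lemma adjoint_diag_op:
  "adjoint_operator (supported I) (diag_op I a) = diag_op I (\<lambda>n. cnj (a n))" (is "?L = ?R")
proof -
  have kets: "ket ` I \<subseteq> dom (diag_op I a)" by (simp add: image_subset_iff ket_in_dom_diag_op)
  have "?L \<psi> = Some \<phi> \<longleftrightarrow> ?R \<psi> = Some \<phi>" for \<psi> \<phi>
  proof
    assume L: "?L \<psi> = Some \<phi>"
    note * = adjoint_eq_SomeD[OF kets L]
    have "coord \<phi> n = cnj (a n) * coord \<psi> n" for n
    proof (cases "n \<in> I")
      case True
      then show ?thesis using *(3)[OF ket_in_dom_diag_op[OF True]]
        by (simp add: diag_op_ket cinner_scaleC_left cinner_ket_left)
    qed (use *(1,2) in \<open>simp add: supported_def\<close>)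
    then show "?R \<psi> = Some \<phi>" using *(1) by (simp add: diag_op_eq_Some_iff)
  next
    assume "?R \<psi> = Some \<phi>"
    then have *: "\<psi> \<in> supported I" "\<And>n. coord \<phi> n = cnj (a n) * coord \<psi> n"
      by (auto simp: diag_op_eq_Some_iff)
    show "?L \<psi> = Some \<phi>"
    proof (rule adjoint_eq_SomeI[OF kets *(1)])
      show "\<phi> \<in> supported I" using * by (simp add: supported_def)
      fix \<xi> assume "\<xi> \<in> dom (diag_op I a)"
      then show "cinner (the (diag_op I a \<xi>)) \<psi> = cinner \<xi> \<phi>"
        unfolding cinner_def by (intro infsum_cong) (simp only: coord_diag_op *(2) complex_cnj_mult mult_ac)
    qed
  qed
  then show ?thesis by (rule operator_eqI)
qed

text \<open>Two graph inclusions. A pair in \<open>S\<close> is a pair in its adjoint, and testing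
  on kets places it in the diagonal operator. Given this, real entries move across the inner
  product, so a pair of the diagonal operator lies in the adjoint of \<open>S\<close>, which is
  \<open>S\<close>.\<close>

lemma self_adjoint_diagonal_eq_diag_op:
  assumes sa: "self_adjoint (supported I) S"
    and diag: "\<And>n. n \<in> I \<Longrightarrow> S (ket n) = Some (complex_of_real (s n) *\<^sub>C ket n)"
  shows "S = diag_op I (\<lambda>n. complex_of_real (s n))" (is "_ = ?D")
proof -
  have kets: "ket ` I \<subseteq> dom S" using diag by auto
  have adj: "adjoint_operator (supported I) S = S" using sa by (simp add: self_adjoint_def)
  have sub: "?D \<psi> = Some \<phi>" if "S \<psi> = Some \<phi>" for \<psi> \<phi>
  proof -
    have L: "adjoint_operator (supported I) S \<psi> = Some \<phi>" using that adj by simp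
    note * = adjoint_eq_SomeD[OF kets L]
    have "coord \<phi> n = s n * coord \<psi> n" for n
    proof (cases "n \<in> I")
      case True
      then have "ket n \<in> dom S" using kets by blast
      from *(3)[OF this] show ?thesis using diag[OF True]
        by (simp add: cinner_scaleC_left cinner_ket_left)
    qed (use *(1,2) in \<open>simp add: supported_def\<close>)
    then show ?thesis using *(1) by (simp add: diag_op_eq_Some_iff)
  qed
  have "S \<psi> = Some \<phi>" if "?D \<psi> = Some \<phi>" for \<psi> \<phi>
  proof -
    have *: "\<psi> \<in> supported I" "\<And>n. coord \<phi> n = s n * coord \<psi> n"
      using that by (auto simp: diag_op_eq_Some_iff)
    have "adjoint_operator (supported I) S \<psi> = Some \<phi>"
    proof (rule adjoint_eq_SomeI[OF kets *(1)])
      show "\<phi> \<in> supported I" using * by (simp add: supported_def)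
      fix \<xi> assume "\<xi> \<in> dom S"
      then obtain \<zeta> where "S \<xi> = Some \<zeta>" by auto
      then show "cinner (the (S \<xi>)) \<psi> = cinner \<xi> \<phi>"
        using sub[of \<xi> \<zeta>] unfolding cinner_def
        by (intro infsum_cong) (simp add: diag_op_eq_Some_iff *(2) mult_ac)
    qed
    then show ?thesis by (simp add: adj)
  qed
  with sub show ?thesis by (intro operator_eqI iffI)
qed

section \<open>Shifts, multiples and the spectrum of diagonal operators\<close>

lemma shift_operator_diag_op: "shift_operator (diag_op I a) z = diag_op I (\<lambda>n. a n - z)"
proof -
  have "shift_operator (diag_op I a) z \<psi> = Some \<phi> \<longleftrightarrow> diag_op I (\<lambda>n. a n - z) \<psi> = Some \<phi>" for \<psi> \<phi>
  proof
    assume "shift_operator (diag_op I a) z \<psi> = Some \<phi>"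
    then show "diag_op I (\<lambda>n. a n - z) \<psi> = Some \<phi>"
      by (auto simp: shift_operator_def diag_op_eq_Some_iff left_diff_distrib)
  next
    assume "diag_op I (\<lambda>n. a n - z) \<psi> = Some \<phi>"
    then have "diag_op I a \<psi> = Some (\<phi> + z *\<^sub>C \<psi>)"
      by (simp add: diag_op_eq_Some_iff algebra_simps)
    then show "shift_operator (diag_op I a) z \<psi> = Some \<phi>" by (simp add: shift_operator_def)
  qed
  then show ?thesis by (rule operator_eqI)
qed

text \<open>For \<open>c = 0\<close> the domains could differ: the scaled operator keeps the old
  domain, while the zero diagonal is defined on all of \<open>supported I\<close>.\<close>

lemma scale_operator_diag_op:
  assumes "c \<noteq> 0"
  shows "scale_operator c (diag_op I a) = diag_op I (\<lambda>n. c * a n)"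
proof -
  have "scale_operator c (diag_op I a) \<psi> = Some \<phi> \<longleftrightarrow> diag_op I (\<lambda>n. c * a n) \<psi> = Some \<phi>" for \<psi> \<phi>
  proof
    assume "scale_operator c (diag_op I a) \<psi> = Some \<phi>"
    then show "diag_op I (\<lambda>n. c * a n) \<psi> = Some \<phi>"
      by (auto simp: scale_operator_def diag_op_eq_Some_iff)
  next
    assume "diag_op I (\<lambda>n. c * a n) \<psi> = Some \<phi>"
    then have "diag_op I a \<psi> = Some (inverse c *\<^sub>C \<phi>)"
      using assms by (simp add: diag_op_eq_Some_iff)
    then show "scale_operator c (diag_op I a) \<psi> = Some \<phi>" using assms by (simp add: scale_operator_def)
  qed
  then show ?thesis by (rule operator_eqI)
qed

text \<open>A bounded left inverse of the shifted operator returns the unit vector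
  \<open>ket n\<close> from \<open>(a n - z) *\<^sub>C ket n\<close>, which keeps the entries at a
  positive distance from \<open>z\<close>.\<close>

lemma closure_subset_spectrum_diag_op:
  assumes z: "z \<in> closure (a ` I)"
  shows "z \<in> spectrum (supported I) (diag_op I a)"
proof (rule ccontr)
  assume "z \<notin> spectrum (supported I) (diag_op I a)"
  then obtain R where R: "bounded_operator (supported I) R"
    and inv: "R \<circ>\<^sub>m diag_op I (\<lambda>n. a n - z) = Some |` dom (diag_op I a)"
    by (auto simp: spectrum_def shift_operator_diag_op)
  obtain C where C: "\<And>\<psi>. \<psi> \<in> supported I \<Longrightarrow> norm (the (R \<psi>)) \<le> C * norm \<psi>"
    using R by (auto simp: bounded_operator_def)
  have one: "1 \<le> C * cmod (a n - z)" if n: "n \<in> I" for n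
  proof -
    have "(R \<circ>\<^sub>m diag_op I (\<lambda>n. a n - z)) (ket n) = Some (ket n)"
      unfolding inv using n by (simp add: ket_in_dom_diag_op)
    then have "R ((a n - z) *\<^sub>C ket n) = Some (ket n)" using n by (simp add: diag_op_ket)
    moreover have "(a n - z) *\<^sub>C ket n \<in> supported I"
      using n subspace_supported[of I] by (simp add: ell2_vs.subspace_def)
    ultimately show ?thesis using C[of "(a n - z) *\<^sub>C ket n"] by (simp add: norm_scaleC)
  qed
  \<comment> \<open>Using \<open>\<bar>C\<bar> + 1\<close> makes the denominator positive; an entry
    closer to \<open>z\<close> than \<open>e\<close> contradicts \<open>one\<close>.\<close>
  define e where "e = 1 / (\<bar>C\<bar> + 1)"
  have "e > 0" by (simp add: e_def add_nonneg_pos)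
  then have "\<exists>y\<in>a ` I. dist y z < e" using z unfolding closure_approachable by blast
  then obtain n where "n \<in> I" and d: "dist (a n) z < e" by auto
  have "C * cmod (a n - z) \<le> (\<bar>C\<bar> + 1) * cmod (a n - z)" by (intro mult_right_mono) auto
  also have "\<dots> < 1" using d by (auto simp: e_def dist_norm field_simps)
  finally show False using one[OF \<open>n \<in> I\<close>] by simp
qed

text \<open>Off the closure the entries stay at distance at least \<open>e\<close> from
  \<open>z\<close>, so their shifted reciprocals are bounded by \<open>inverse e\<close> and form
  the resolvent.\<close>

lemma spectrum_diag_op: "spectrum (supported I) (diag_op I a) = closure (a ` I)"
proof (intro antisym subsetI)
  fix z assume z: "z \<in> spectrum (supported I) (diag_op I a)"
  show "z \<in> closure (a ` I)"
  proof (rule ccontr)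
    assume "z \<notin> closure (a ` I)"
    then obtain e where e: "e > 0" "\<And>n. n \<in> I \<Longrightarrow> e \<le> dist (a n) z"
      unfolding closure_approachable by (auto simp: not_less)
    define r where "r = (\<lambda>n. inverse (a n - z))"
    have nz: "a n \<noteq> z" if "n \<in> I" for n using e(1) e(2)[OF that] by auto
    have "cmod (r n) \<le> inverse e" if "n \<in> I" for n
      using e(1) e(2)[OF that] by (auto simp: r_def norm_inverse dist_norm intro!: le_imp_inverse_le)
    then have bdd: "bounded_operator (supported I) (diag_op I r)"
      by (rule bounded_operator_diag_op)
    have cancel: "r n * (a n - z) * coord \<psi> n = coord \<psi> n" if "\<psi> \<in> supported I" for \<psi> n
      using that nz by (cases "n \<in> I") (auto simp: r_def supported_def)
    \<comment> \<open>Shifting leaves the domain unchanged by the very definition of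
      \<open>shift_operator\<close>, which spares a summability estimate.\<close>
    have domeq: "dom (diag_op I (\<lambda>n. a n - z)) = dom (diag_op I a)"
      unfolding shift_operator_diag_op[symmetric] by (auto simp: shift_operator_def)
    have "(diag_op I r \<circ>\<^sub>m diag_op I (\<lambda>n. a n - z)) \<psi> = Some \<phi> \<longleftrightarrow>
        (Some |` dom (diag_op I a)) \<psi> = Some \<phi>" for \<psi> \<phi>
    proof (cases "\<psi> \<in> dom (diag_op I a)")
      case True
      then have "\<psi> \<in> supported I" by (simp add: dom_diag_op)
      with True show ?thesis
        using cancel[of \<psi>] by (auto simp only: diag_op_comp_Some_iff domeq restrict_in intro: coord_eqI)
    next
      case False
      then show ?thesis by (simp only: diag_op_comp_Some_iff domeq restrict_out option.distinct) simp
    qed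
    moreover have "(diag_op I (\<lambda>n. a n - z) \<circ>\<^sub>m diag_op I r) \<psi> = Some \<phi> \<longleftrightarrow>
        (Some |` supported I) \<psi> = Some \<phi>" for \<psi> \<phi>
    proof -
      have "dom (diag_op I r) = supported I" using bdd by (simp add: bounded_operator_def)
      then show ?thesis using cancel[of \<psi>]
        by (auto simp: diag_op_comp_Some_iff restrict_map_def mult.commute[of _ "r _"] intro: coord_eqI)
    qed
    ultimately have
      "shift_operator (diag_op I a) z \<circ>\<^sub>m diag_op I r = Some |` supported I"
      "diag_op I r \<circ>\<^sub>m shift_operator (diag_op I a) z = Some |` dom (diag_op I a)"
      by (simp_all only: shift_operator_diag_op operator_eqI)
    with bdd z show False unfolding spectrum_def by blast
  qed
qed (rule closure_subset_spectrum_diag_op)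

section \<open>The spectral measure of a diagonal operator\<close>

text \<open>Absolute summability allows the inner product to be read as an integral over the
  counting measure.\<close>

lemma abs_summable_cinner: "(\<lambda>n. norm (cnj (coord \<psi> n) * coord \<phi> n)) summable_on UNIV"
proof (rule Infinite_Sum.abs_summable_product)
  show "(\<lambda>n. norm (cnj (coord \<psi> n) * cnj (coord \<psi> n))) summable_on UNIV"
    "(\<lambda>n. norm (coord \<phi> n * coord \<phi> n)) summable_on UNIV"
    using coord_square_summable[of \<psi> UNIV] coord_square_summable[of \<phi> UNIV]
    by (simp_all add: norm_mult power2_eq_square)
qed

text \<open>Links the two descriptions of a domain: finite integral for spectral integrals,
  summability for \<open>diag_op\<close>.\<close>

lemma nn_integral_count_space_finite_iff:
  fixes f :: "'a \<Rightarrow> real"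
  assumes "\<And>n. 0 \<le> f n"
  shows "(\<integral>\<^sup>+n. ennreal (f n) \<partial>count_space UNIV) < \<infinity> \<longleftrightarrow> f summable_on UNIV"
proof -
  have "f summable_on UNIV \<longleftrightarrow> (\<lambda>n. norm (f n)) summable_on UNIV" using assms by simp
  also have "\<dots> \<longleftrightarrow> integrable (count_space UNIV) f"
    using abs_summable_equivalent[of f UNIV] unfolding Infinite_Set_Sum.abs_summable_on_def .
  also have "\<dots> \<longleftrightarrow> (\<integral>\<^sup>+n. ennreal (f n) \<partial>count_space UNIV) < \<infinity>"
    using assms by (simp add: integrable_iff_bounded)
  finally show ?thesis by simp
qed

text \<open>Its image under \<open>s\<close> is the scalar spectral measure of \<psi> for the
  diagonal operator with entries \<open>s n\<close>; see
  \<open>scalar_measure_diag_pvm\<close>.\<close>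

definition weight_measure :: "'a ell2 \<Rightarrow> 'a measure" where
  "weight_measure \<psi> = density (count_space UNIV) (\<lambda>n. ennreal ((cmod (coord \<psi> n))\<^sup>2))"

lemma sets_weight_measure [simp, measurable_cong]: "sets (weight_measure \<psi>) = UNIV"
  and space_weight_measure [simp]: "space (weight_measure \<psi>) = UNIV"
  by (simp_all add: weight_measure_def)

lemma measurable_weight_measure [simp]: "s \<in> measurable (weight_measure \<psi>) M \<longleftrightarrow> range s \<subseteq> space M"
  by (auto simp: measurable_def)

lemma emeasure_weight_measure:
  "emeasure (weight_measure \<psi>) A = ennreal (\<Sum>\<^sub>\<infinity>n\<in>A. (cmod (coord \<psi> n))\<^sup>2)"
proof -
  let ?f = "\<lambda>n. (cmod (coord \<psi> n))\<^sup>2"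
  have "(\<lambda>n. norm (?f n)) summable_on A"
    using coord_square_summable[of \<psi> A] by simp
  then have *: "Infinite_Set_Sum.abs_summable_on ?f A"
    unfolding abs_summable_equivalent[symmetric] .
  have "emeasure (weight_measure \<psi>) A = (\<integral>\<^sup>+n. ennreal (?f n) * indicator A n \<partial>count_space UNIV)"
    unfolding weight_measure_def by (subst emeasure_density) auto
  also have "\<dots> = (\<integral>\<^sup>+n. ennreal (?f n) \<partial>count_space A)"
    by (simp add: nn_integral_count_space_indicator)
  also have "\<dots> = ennreal (infsetsum ?f A)"
    by (rule nn_integral_conv_infsetsum[OF *]) auto
  also have "infsetsum ?f A = infsum ?f A"
    by (rule infsetsum_infsum[OF *])
  finally show ?thesis .
qed

lemma finite_measure_weight_measure: "finite_measure (weight_measure \<psi>)"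
  by (rule finite_measureI) (simp add: emeasure_weight_measure)

lemma measure_weight_measure: "measure (weight_measure \<psi>) A = (\<Sum>\<^sub>\<infinity>n\<in>A. (cmod (coord \<psi> n))\<^sup>2)"
  by (simp add: measure_def emeasure_weight_measure infsum_nonneg)

section \<open>The projection-valued measure of a diagonal operator\<close>

definition diag_pvm :: "'a set \<Rightarrow> ('a \<Rightarrow> real) \<Rightarrow> real set \<Rightarrow> 'a operator" where
  "diag_pvm I s B = diag_op I (\<lambda>n. of_bool (s n \<in> B))"

lemma bounded_operator_diag_pvm: "bounded_operator (supported I) (diag_pvm I s B)"
  unfolding diag_pvm_def by (rule bounded_operator_diag_op[of _ _ 1]) auto

lemma dom_diag_pvm: "dom (diag_pvm I s B) = supported I"
  using bounded_operator_diag_pvm[of I s B] by (simp add: bounded_operator_def)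

lemma coord_diag_pvm:
  "\<psi> \<in> supported I \<Longrightarrow> coord (the (diag_pvm I s B \<psi>)) n = of_bool (s n \<in> B) * coord \<psi> n"
  using coord_diag_op[of \<psi> I "\<lambda>n. of_bool (s n \<in> B)"] dom_diag_pvm[of I s B]
  by (simp add: diag_pvm_def)

lemma norm_diag_pvm:
  assumes "\<psi> \<in> supported I"
  shows "(norm (the (diag_pvm I s B \<psi>)))\<^sup>2 = measure (weight_measure \<psi>) (s -` B)"
  unfolding norm_square_ell2 measure_weight_measure coord_diag_pvm[OF assms]
  by (rule infsum_cong_neutral) auto

text \<open>A multiplier with values 0 and 1 is real and idempotent, so it may be applied to both
  arguments of the inner product.\<close>

lemma cinner_diag_pvm:
  assumes "\<psi> \<in> supported I"
  shows "cinner \<psi> (the (diag_pvm I s B \<psi>)) = measure (weight_measure \<psi>) (s -` B)"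
proof -
  have "cinner \<psi> (the (diag_pvm I s B \<psi>))
      = cinner (the (diag_pvm I s B \<psi>)) (the (diag_pvm I s B \<psi>))"
    unfolding cinner_def by (rule infsum_cong) (simp add: coord_diag_pvm[OF assms])
  then show ?thesis
    using norm_diag_pvm[OF assms] by (simp only: cinner_self_norm)
qed

text \<open>The Borel sets are already a sigma-algebra, so \<open>measure_of\<close> reads the set
  function on them only.\<close>

lemma scalar_measure_cong:
  assumes "\<And>B. B \<in> sets borel \<Longrightarrow> E B \<psi> = E' B \<psi>"
  shows "scalar_measure E \<psi> = scalar_measure E' \<psi>"
  unfolding scalar_measure_def
proof (rule measure_of_eq)
  have "sigma_sets UNIV (sets (borel :: real measure)) = sets borel"
    using sets.sigma_sets_eq[of "borel :: real measure"] by simp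
  then show "ennreal (Re (cinner \<psi> (the (E B \<psi>)))) = ennreal (Re (cinner \<psi> (the (E' B \<psi>))))"
    if "B \<in> sigma_sets UNIV (sets borel)" for B
    using assms[of B] that by simp
qed auto

lemma scalar_measure_eqI:
  fixes N :: "real measure"
  assumes sets: "sets N = sets borel"
    and eq: "\<And>B. B \<in> sets borel \<Longrightarrow> emeasure N B = ennreal (Re (cinner \<psi> (the (E B \<psi>))))"
  shows "scalar_measure E \<psi> = N"
proof -
  have sp: "space N = UNIV" using sets_eq_imp_space_eq[OF sets] by simp
  have "scalar_measure E \<psi> = measure_of UNIV (sets borel) (emeasure N)"
    unfolding scalar_measure_def
  proof (rule measure_of_eq)
    have "sigma_sets UNIV (sets (borel :: real measure)) = sets borel"
      using sets.sigma_sets_eq[of "borel :: real measure"] by simp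
    then show "ennreal (Re (cinner \<psi> (the (E B \<psi>)))) = emeasure N B"
      if "B \<in> sigma_sets UNIV (sets borel)" for B
      using eq[of B] that by simp
  qed auto
  also have "\<dots> = N"
    using measure_of_of_measure[of N] by (simp add: sp sets)
  finally show ?thesis .
qed

lemma scalar_measure_diag_pvm:
  fixes s :: "'a \<Rightarrow> real"
  assumes \<psi>: "\<psi> \<in> supported I"
  shows "scalar_measure (diag_pvm I s) \<psi> = distr (weight_measure \<psi>) borel s"
proof (rule scalar_measure_eqI)
  fix B :: "real set" assume B: "B \<in> sets borel"
  interpret finite_measure "weight_measure \<psi>" by (rule finite_measure_weight_measure)
  show "emeasure (distr (weight_measure \<psi>) borel s) B
      = ennreal (Re (cinner \<psi> (the (diag_pvm I s B \<psi>))))"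
    by (simp add: emeasure_distr B cinner_diag_pvm[OF \<psi>] emeasure_eq_measure)
qed simp

lemma projection_diag_pvm: "orthogonal_projection (supported I) (diag_pvm I s B)"
  unfolding orthogonal_projection_def
proof (intro conjI bounded_operator_diag_pvm)
  show "diag_pvm I s B \<circ>\<^sub>m diag_pvm I s B = diag_pvm I s B"
  proof (rule operator_eqI)
    fix \<psi> \<phi>
    show "(diag_pvm I s B \<circ>\<^sub>m diag_pvm I s B) \<psi> = Some \<phi> \<longleftrightarrow> diag_pvm I s B \<psi> = Some \<phi>"
      using dom_diag_pvm[of I s B] unfolding diag_pvm_def diag_op_comp_Some_iff
      by (simp add: diag_op_eq_Some_iff flip: of_bool_conj)
  qed
  show "adjoint_operator (supported I) (diag_pvm I s B) = diag_pvm I s B"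
    unfolding diag_pvm_def adjoint_diag_op by (simp add: of_bool_def if_distrib cong: if_cong)
qed

text \<open>Countable additivity in norm reduces to that of \<open>weight_measure\<close>: the
  squared norm of a remainder of the series is the measure of the part not yet covered.\<close>

lemma projection_valued_measure_diag_pvm:
  "projection_valued_measure (supported I) (diag_pvm I s)"
  unfolding projection_valued_measure_def
proof (intro conjI ballI allI impI projection_diag_pvm)
  show "diag_pvm I s UNIV = Some |` supported I"
  proof (rule operator_eqI)
    fix \<psi> \<phi>
    show "diag_pvm I s UNIV \<psi> = Some \<phi> \<longleftrightarrow> (Some |` supported I) \<psi> = Some \<phi>"
      by (auto simp: diag_pvm_def diag_op_eq_Some_iff restrict_map_def intro: coord_eqI)
  qed
next
  fix B :: "nat \<Rightarrow> real set" and \<psi> :: "'a ell2"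
  assume disj: "disjoint_family B" and \<psi>: "\<psi> \<in> supported I"
  let ?M = "weight_measure \<psi>" and ?P = "\<lambda>B. the (diag_pvm I s B \<psi>)"
  interpret finite_measure ?M by (rule finite_measure_weight_measure)
  \<comment> \<open>By disjointness the indicators of the first \<open>N\<close> sets add up to the
    indicator of their union.\<close>
  have c: "coord (\<Sum>k<N. ?P (B k)) n = of_bool (s n \<in> (\<Union>k<N. B k)) * coord \<psi> n" for N n
  proof (induction N)
    case (Suc N)
    have "B N \<inter> (\<Union>k<N. B k) = {}"
      using disjoint_family_onD[OF disj, of N] by (auto simp: disjoint_iff)
    then have "of_bool (s n \<in> (\<Union>k<Suc N. B k)) =
        (of_bool (s n \<in> B N) + of_bool (s n \<in> (\<Union>k<N. B k)) :: complex)"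
      by (auto simp: lessThan_Suc)
    then show ?case
      using Suc by (simp del: coord_sum UN_iff add: coord_diag_pvm[OF \<psi>] distrib_right)
  qed simp
  have diff: "(norm (?P (\<Union>k. B k) - (\<Sum>k<N. ?P (B k))))\<^sup>2
      = measure ?M (s -` (\<Union>k. B k)) - (\<Sum>k<N. measure ?M (s -` B k))" for N
  proof -
    \<comment> \<open>The remainder is itself a projection of \<psi>, so
      \<open>norm_diag_pvm\<close> computes its norm.\<close>
    have "?P (\<Union>k. B k) - (\<Sum>k<N. ?P (B k)) = ?P ((\<Union>k. B k) - (\<Union>k<N. B k))"
      by (rule coord_eqI) (auto simp: c coord_diag_pvm[OF \<psi>] simp del: coord_sum)
    then have "(norm (?P (\<Union>k. B k) - (\<Sum>k<N. ?P (B k))))\<^sup>2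
        = measure ?M (s -` (\<Union>k. B k) - s -` (\<Union>k<N. B k))"
      by (simp add: norm_diag_pvm[OF \<psi>] vimage_Diff)
    also have "\<dots> = measure ?M (s -` (\<Union>k. B k)) - measure ?M (s -` (\<Union>k<N. B k))"
      by (rule finite_measure_Diff) auto
    also have "measure ?M (s -` (\<Union>k<N. B k)) = (\<Sum>k<N. measure ?M (s -` B k))"
      unfolding vimage_UN
      by (rule finite_measure_finite_Union)
         (auto intro: disjoint_family_on_mono[OF _ disjoint_family_on_vimageI[OF disj]])
    finally show ?thesis .
  qed
  have "(\<lambda>k. measure ?M (s -` B k)) sums measure ?M (\<Union>k. s -` B k)"
    by (rule finite_measure_UNION) (auto intro: disjoint_family_on_vimageI[OF disj])
  then have "(\<lambda>N. measure ?M (s -` (\<Union>k. B k)) - (\<Sum>k<N. measure ?M (s -` B k))) \<longlonglongrightarrow>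
      measure ?M (s -` (\<Union>k. B k)) - measure ?M (s -` (\<Union>k. B k))"
    unfolding sums_def vimage_UN by (intro tendsto_diff tendsto_const)
  then have "(\<lambda>N. (norm (?P (\<Union>k. B k) - (\<Sum>k<N. ?P (B k))))\<^sup>2) \<longlonglongrightarrow> 0"
    unfolding diff by simp
  then have "(\<lambda>N. norm (?P (\<Union>k. B k) - (\<Sum>k<N. ?P (B k)))) \<longlonglongrightarrow> 0"
    using tendsto_real_sqrt[of _ 0] by (simp add: real_sqrt_abs)
  then show "(\<lambda>k. ?P (B k)) sums ?P (\<Union>k. B k)"
    unfolding sums_def by (subst LIM_zero_iff[symmetric], subst tendsto_norm_zero_iff[symmetric])
      (simp only: norm_minus_commute)
qed

text \<open>Change of variables along \<open>s\<close> turns integrals against the scalar measure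
  into sums over the index set weighted by the squared coordinates.\<close>

lemma is_spectral_integral_diag_pvm:
  fixes s :: "'a \<Rightarrow> real"
  assumes g [measurable]: "g \<in> borel_measurable borel"
  shows "is_spectral_integral (supported I) (diag_pvm I s) g (diag_op I (\<lambda>n. g (s n)))"
  unfolding is_spectral_integral_def
proof (intro conjI linear_operator_diag_op ballI)
  have "(\<integral>\<^sup>+x. ennreal ((cmod (g x))\<^sup>2) \<partial>scalar_measure (diag_pvm I s) \<psi>) < \<infinity> \<longleftrightarrow>
      (\<lambda>n. (cmod (g (s n) * coord \<psi> n))\<^sup>2) summable_on UNIV" if "\<psi> \<in> supported I" for \<psi>
  proof -
    have "(\<integral>\<^sup>+x. ennreal ((cmod (g x))\<^sup>2) \<partial>scalar_measure (diag_pvm I s) \<psi>)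
        = (\<integral>\<^sup>+n. ennreal ((cmod (g (s n)))\<^sup>2) \<partial>weight_measure \<psi>)"
      unfolding scalar_measure_diag_pvm[OF that] by (subst nn_integral_distr) auto
    also have "\<dots> = (\<integral>\<^sup>+n. ennreal ((cmod (g (s n) * coord \<psi> n))\<^sup>2) \<partial>count_space UNIV)"
      unfolding weight_measure_def
      by (subst nn_integral_density)
         (auto simp: norm_mult power_mult_distrib mult.commute simp flip: ennreal_mult)
    finally show ?thesis
      using nn_integral_count_space_finite_iff[of "\<lambda>n. (cmod (g (s n) * coord \<psi> n))\<^sup>2"] by simp
  qed
  then show "dom (diag_op I (\<lambda>n. g (s n))) =
      {\<psi> \<in> supported I. (\<integral>\<^sup>+x. ennreal ((cmod (g x))\<^sup>2) \<partial>scalar_measure (diag_pvm I s) \<psi>) < \<infinity>}"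
    unfolding dom_diag_op by blast
next
  fix \<psi> assume dom: "\<psi> \<in> dom (diag_op I (\<lambda>n. g (s n)))"
  then have \<psi>: "\<psi> \<in> supported I" by (simp add: dom_diag_op)
  let ?h = "\<lambda>n. cnj (coord \<psi> n) * coord (the (diag_op I (\<lambda>n. g (s n)) \<psi>)) n"
  have "(LINT x|scalar_measure (diag_pvm I s) \<psi>. g x) = (LINT n|weight_measure \<psi>. g (s n))"
    unfolding scalar_measure_diag_pvm[OF \<psi>] by (subst integral_distr) auto
  also have "\<dots> = (LINT n|count_space UNIV. (cmod (coord \<psi> n))\<^sup>2 *\<^sub>R g (s n))"
    unfolding weight_measure_def by (subst integral_density) auto
  \<comment> \<open>\<open>infsetsum\<close> is the Bochner integral over the counting measure;
    absolute summability then identifies it with \<open>infsum\<close>.\<close>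
  also have "\<dots> = infsetsum ?h UNIV"
    unfolding infsetsum_def
    unfolding coord_diag_op[OF dom] scaleR_conv_of_real complex_norm_square
    by (rule Bochner_Integration.integral_cong) (simp_all add: mult_ac)
  also have "\<dots> = infsum ?h UNIV"
    by (rule infsetsum_infsum) (simp only: abs_summable_equivalent[symmetric] abs_summable_cinner)
  finally show "cinner \<psi> (the (diag_op I (\<lambda>n. g (s n)) \<psi>)) = (LINT x|scalar_measure (diag_pvm I s) \<psi>. g x)"
    by (simp add: cinner_def)
qed

lemma spectral_measure_of_diag_op:
  "spectral_measure_of (supported I) (diag_op I (\<lambda>n. complex_of_real (s n))) (diag_pvm I s)"
  unfolding spectral_measure_of_def
  by (intro conjI projection_valued_measure_diag_pvm is_spectral_integral_diag_pvm) simp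

section \<open>Uniqueness of spectral measures and spectral integrals\<close>

locale spectral_family =
  fixes I :: "'a set" and E :: "real set \<Rightarrow> 'a operator"
  assumes pvm: "projection_valued_measure (supported I) E"
begin

abbreviation P :: "real set \<Rightarrow> 'a ell2 \<Rightarrow> 'a ell2" where
  "P B \<psi> \<equiv> the (E B \<psi>)"

lemma projection: "B \<in> sets borel \<Longrightarrow> orthogonal_projection (supported I) (E B)"
  using pvm by (simp add: projection_valued_measure_def)

lemma bounded: "B \<in> sets borel \<Longrightarrow> bounded_operator (supported I) (E B)"
  using projection by (simp add: orthogonal_projection_def)

lemma linear: "B \<in> sets borel \<Longrightarrow> linear_operator (supported I) (E B)"
  using bounded by (simp add: bounded_operator_def)

lemma dom_E: "B \<in> sets borel \<Longrightarrow> dom (E B) = supported I"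
  using bounded by (simp add: bounded_operator_def)

lemma E_eq: "B \<in> sets borel \<Longrightarrow> \<psi> \<in> supported I \<Longrightarrow> E B \<psi> = Some (P B \<psi>)"
  using dom_E[of B] domD[of \<psi> "E B"] by auto

lemma P_supported: "B \<in> sets borel \<Longrightarrow> \<psi> \<in> supported I \<Longrightarrow> P B \<psi> \<in> supported I"
  using linear[of B] ranI[of "E B", OF E_eq[of B \<psi>]] by (auto simp: linear_operator_def)

lemma P_add:
  "B \<in> sets borel \<Longrightarrow> \<psi> \<in> supported I \<Longrightarrow> \<phi> \<in> supported I \<Longrightarrow> P B (\<psi> + \<phi>) = P B \<psi> + P B \<phi>"
  using linear[of B] dom_E[of B] by (simp add: linear_operator_def)

lemma P_scale: "B \<in> sets borel \<Longrightarrow> \<psi> \<in> supported I \<Longrightarrow> P B (c *\<^sub>C \<psi>) = c *\<^sub>C P B \<psi>"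
  using linear[of B] dom_E[of B] by (simp add: linear_operator_def)

lemma P_idem:
  assumes "B \<in> sets borel" "\<psi> \<in> supported I"
  shows "P B (P B \<psi>) = P B \<psi>"
proof -
  obtain \<phi> where \<phi>: "E B \<psi> = Some \<phi>" using E_eq[OF assms] by blast
  have "(E B \<circ>\<^sub>m E B) \<psi> = E B \<psi>"
    using projection[OF assms(1)] by (simp add: orthogonal_projection_def)
  then show ?thesis by (simp add: \<phi>)
qed

lemma P_symmetric:
  assumes "B \<in> sets borel" "\<psi> \<in> supported I" "\<phi> \<in> supported I"
  shows "cinner (P B \<phi>) \<psi> = cinner \<phi> (P B \<psi>)"
proof (rule adjoint_eq_SomeD(3)[of I "E B"])
  show "ket ` I \<subseteq> dom (E B)" "\<phi> \<in> dom (E B)"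
    using assms by (simp_all add: dom_E image_subset_iff)
  have adj: "adjoint_operator (supported I) (E B) = E B"
    using projection[OF assms(1)] by (simp add: orthogonal_projection_def)
  show "adjoint_operator (supported I) (E B) \<psi> = Some (P B \<psi>)"
    unfolding adj by (rule E_eq[OF assms(1,2)])
qed

lemma P_UNIV: "\<psi> \<in> supported I \<Longrightarrow> P UNIV \<psi> = \<psi>"
  using pvm by (simp add: projection_valued_measure_def restrict_map_def)

lemma P_sums:
  assumes "range B \<subseteq> sets borel" "disjoint_family B" "\<psi> \<in> supported I"
  shows "(\<lambda>k. P (B k) \<psi>) sums P (\<Union>k. B k) \<psi>"
  using pvm assms unfolding projection_valued_measure_def by blast

text \<open>The empty set is a disjoint union of infinitely many copies of itself, and a constant
  series converges only if its term is 0.\<close>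

lemma P_empty:
  assumes "\<psi> \<in> supported I"
  shows "P {} \<psi> = 0"
proof -
  have "(\<lambda>k::nat. P {} \<psi>) sums P {} \<psi>"
    using P_sums[of "\<lambda>_. {}"] assms by (simp add: disjoint_family_on_def)
  then have "(\<lambda>k::nat. P {} \<psi>) \<longlonglongrightarrow> 0"
    by (rule summable_LIMSEQ_zero[OF sums_summable])
  then show ?thesis by (simp add: LIMSEQ_const_iff)
qed

text \<open>Finite additivity follows from the countable one by padding with empty sets.\<close>

lemma P_Un:
  assumes "A \<in> sets borel" "B \<in> sets borel" "A \<inter> B = {}" and \<psi>: "\<psi> \<in> supported I"
  shows "P (A \<union> B) \<psi> = P A \<psi> + P B \<psi>"
proof -
  have "disjoint_family (binaryset A B)"
    using assms(3) by (auto simp: disjoint_family_on_def binaryset_def)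
  then have "(\<lambda>k. P (binaryset A B k) \<psi>) sums P (A \<union> B) \<psi>"
    using P_sums[of "binaryset A B" \<psi>] assms by (simp add: range_binaryset_eq UN_binaryset_eq)
  moreover have "(\<lambda>k. P (binaryset A B k) \<psi>) sums (P A \<psi> + P B \<psi>)"
    by (rule binaryset_sums) (rule P_empty[OF \<psi>])
  ultimately show ?thesis by (rule sums_unique2)
qed

lemma cinner_P:
  assumes "B \<in> sets borel" "\<psi> \<in> supported I"
  shows "cinner \<psi> (P B \<psi>) = complex_of_real ((norm (P B \<psi>))\<^sup>2)"
proof -
  have "cinner \<psi> (P B \<psi>) = cinner \<psi> (P B (P B \<psi>))" by (simp add: P_idem assms)
  also have "\<dots> = cinner (P B \<psi>) (P B \<psi>)" by (simp add: P_symmetric P_supported assms)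
  finally show ?thesis by (simp only: cinner_self_norm)
qed

lemma norm_P_Un:
  assumes "A \<in> sets borel" "B \<in> sets borel" "A \<inter> B = {}" "\<psi> \<in> supported I"
  shows "(norm (P (A \<union> B) \<psi>))\<^sup>2 = (norm (P A \<psi>))\<^sup>2 + (norm (P B \<psi>))\<^sup>2"
proof -
  have AB: "A \<union> B \<in> sets borel" using assms by auto
  have "cinner \<psi> (P (A \<union> B) \<psi>) = cinner \<psi> (P A \<psi>) + cinner \<psi> (P B \<psi>)"
    by (simp add: P_Un assms cinner_add_right)
  then show ?thesis
    unfolding cinner_P[OF AB assms(4)] cinner_P[OF assms(1,4)] cinner_P[OF assms(2,4)]
      of_real_add[symmetric] of_real_eq_iff .
qed

lemma norm_P_le:
  assumes "B \<in> sets borel" "\<psi> \<in> supported I"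
  shows "(norm (P B \<psi>))\<^sup>2 \<le> (norm \<psi>)\<^sup>2"
proof -
  have "- B \<in> sets borel" using assms(1) by (rule borel_comp)
  with assms have "(norm (P (B \<union> - B) \<psi>))\<^sup>2 = (norm (P B \<psi>))\<^sup>2 + (norm (P (- B) \<psi>))\<^sup>2"
    by (intro norm_P_Un) auto
  then show ?thesis by (simp add: P_UNIV assms)
qed

text \<open>Orthogonality comes from a norm count: on the vector \<open>P B \<psi>\<close> the
  projection for \<open>B\<close> already uses up the whole norm, so by additivity nothing is left
  for \<open>A\<close>.\<close>

lemma P_disjoint:
  assumes "A \<in> sets borel" "B \<in> sets borel" "A \<inter> B = {}" "\<psi> \<in> supported I"
  shows "P A (P B \<psi>) = 0"
proof -
  have "(norm (P A (P B \<psi>)))\<^sup>2 + (norm (P B (P B \<psi>)))\<^sup>2 = (norm (P (A \<union> B) (P B \<psi>)))\<^sup>2"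
    using assms by (simp add: norm_P_Un P_supported)
  also have "\<dots> \<le> (norm (P B \<psi>))\<^sup>2"
    using assms by (intro norm_P_le P_supported) auto
  finally show ?thesis by (simp add: P_idem assms)
qed

text \<open>Both sets are split along their intersection; the cross terms vanish by
  \<open>P_disjoint\<close>.\<close>

lemma P_Int:
  assumes "A \<in> sets borel" "B \<in> sets borel" "\<psi> \<in> supported I"
  shows "P A (P B \<psi>) = P (A \<inter> B) \<psi>"
proof -
  have AB: "A \<inter> B \<in> sets borel" "A - B \<in> sets borel" "B - A \<in> sets borel"
    using assms by auto
  have sets: "A \<inter> B \<union> (B - A) = B" "A \<inter> B \<inter> (B - A) = {}"
    "A \<inter> B \<union> (A - B) = A" "A \<inter> B \<inter> (A - B) = {}" by auto
  have "P B \<psi> = P (A \<inter> B) \<psi> + P (B - A) \<psi>"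
    using P_Un[of "A \<inter> B" "B - A" \<psi>] assms AB by (simp only: sets)
  then have "P A (P B \<psi>) = P A (P (A \<inter> B) \<psi>) + P A (P (B - A) \<psi>)"
    using assms AB by (simp add: P_add P_supported)
  also have "P A (P (B - A) \<psi>) = 0"
    using assms AB by (intro P_disjoint) auto
  also have "P A (P (A \<inter> B) \<psi>) = P (A \<inter> B) (P (A \<inter> B) \<psi>) + P (A - B) (P (A \<inter> B) \<psi>)"
    using P_Un[of "A \<inter> B" "A - B" "P (A \<inter> B) \<psi>"] assms AB by (simp only: sets P_supported)
  also have "P (A - B) (P (A \<inter> B) \<psi>) = 0"
    using assms AB by (intro P_disjoint) auto
  finally show ?thesis using assms AB by (simp add: P_idem)
qed

section \<open>Scalar measures and their invariance under phases\<close>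

lemma sets_scalar_measure [simp, measurable_cong]: "sets (scalar_measure E \<psi>) = sets borel"
  using sets.sigma_sets_eq[of "borel :: real measure"] by (simp add: scalar_measure_def)

lemma space_scalar_measure [simp]: "space (scalar_measure E \<psi>) = UNIV"
  by (simp add: scalar_measure_def space_measure_of_conv)

text \<open>\<open>measure_of\<close> returns the prescribed values only for a genuine measure, so
  countable additivity has to be established first.\<close>

lemma emeasure_scalar_measure:
  assumes B: "B \<in> sets borel" and \<psi>: "\<psi> \<in> supported I"
  shows "emeasure (scalar_measure E \<psi>) B = ennreal ((norm (P B \<psi>))\<^sup>2)"
proof -
  have "emeasure (scalar_measure E \<psi>) B = ennreal (Re (cinner \<psi> (P B \<psi>)))"
    unfolding scalar_measure_def
  proof (rule emeasure_measure_of_sigma[OF _ _ _ B])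
    show "sigma_algebra UNIV (sets (borel :: real measure))"
      using sets.sigma_algebra_axioms[of "borel :: real measure"] by simp
    show "positive (sets borel) (\<lambda>B. ennreal (Re (cinner \<psi> (P B \<psi>))))"
      by (simp add: positive_def P_empty[OF \<psi>])
    show "countably_additive (sets borel) (\<lambda>B. ennreal (Re (cinner \<psi> (P B \<psi>))))"
    proof (rule countably_additiveI)
      fix A :: "nat \<Rightarrow> real set"
      assume A: "range A \<subseteq> sets borel" "disjoint_family A"
      \<comment> \<open>The real part of \<open>cinner\<close> is the real inner product, whose
        continuity carries over the norm convergence in \<open>P_sums\<close>.\<close>
      have "(\<lambda>k. Re (cinner \<psi> (P (A k) \<psi>))) sums Re (cinner \<psi> (P (\<Union>k. A k) \<psi>))"
        using bounded_linear.sums[OF bounded_linear_inner_right P_sums[OF A \<psi>], of \<psi>]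
        by (simp add: inner_ell2_def)
      moreover have "0 \<le> Re (cinner \<psi> (P (A k) \<psi>))" for k
        using A(1) by (subst cinner_P[OF _ \<psi>]) auto
      ultimately show "(\<Sum>k. ennreal (Re (cinner \<psi> (P (A k) \<psi>))))
          = ennreal (Re (cinner \<psi> (P (\<Union>k. A k) \<psi>)))"
        by (intro suminf_ennreal_eq)
    qed
  qed
  then show ?thesis by (simp add: cinner_P[OF B \<psi>])
qed

lemma finite_measure_scalar_measure:
  "\<psi> \<in> supported I \<Longrightarrow> finite_measure (scalar_measure E \<psi>)"
  by (rule finite_measureI) (simp add: emeasure_scalar_measure)

lemma P_decomp: "B \<in> sets borel \<Longrightarrow> \<psi> \<in> supported I \<Longrightarrow> P B \<psi> + P (- B) \<psi> = \<psi>"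
  using P_Un[of B "- B" \<psi>] by (simp add: P_UNIV borel_comp)

lemma P_combination:
  assumes "C \<in> sets borel" "B \<in> sets borel" "\<psi> \<in> supported I"
  shows "P C (a *\<^sub>C P B \<psi> + b *\<^sub>C P (- B) \<psi>) = a *\<^sub>C P (C \<inter> B) \<psi> + b *\<^sub>C P (C \<inter> - B) \<psi>"
proof -
  have sc: "c *\<^sub>C \<phi> \<in> supported I" if "\<phi> \<in> supported I" for c \<phi>
    using that subspace_supported[of I] by (simp add: ell2_vs.subspace_def)
  have nB: "- B \<in> sets borel" using assms(2) by (rule borel_comp)
  show ?thesis
    using assms nB by (simp add: P_add P_scale P_supported sc P_Int)
qed

lemma norm_orthogonal_phases:
  assumes "cinner \<psi> \<phi> = 0" "cmod a = 1" "cmod b = 1"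
  shows "(norm (a *\<^sub>C \<psi> + b *\<^sub>C \<phi>))\<^sup>2 = (norm \<psi>)\<^sup>2 + (norm \<phi>)\<^sup>2"
proof -
  have "cinner \<phi> \<psi> = 0" using assms(1) cinner_commute[of \<phi> \<psi>] by simp
  moreover have "a * cnj a = 1" "b * cnj b = 1"
    using assms(2,3) complex_norm_square[of a] complex_norm_square[of b] by simp_all
  ultimately have "cinner (a *\<^sub>C \<psi> + b *\<^sub>C \<phi>) (a *\<^sub>C \<psi> + b *\<^sub>C \<phi>) = cinner \<psi> \<psi> + cinner \<phi> \<phi>"
    using assms(1) by (simp add: cinner_add_left cinner_add_right cinner_scaleC_left
        cinner_scaleC_right mult.assoc[symmetric])
  then show ?thesis
    unfolding cinner_self_norm of_real_add[symmetric] of_real_eq_iff .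
qed

text \<open>For each Borel set \<open>C\<close> the projected vector splits into orthogonal parts
  over \<open>C \<inter> B\<close> and \<open>C \<inter> - B\<close>; unimodular factors do not
  affect the sum of their squared norms.\<close>

lemma scalar_measure_phases:
  assumes B: "B \<in> sets borel" and \<psi>: "\<psi> \<in> supported I" and ab: "cmod a = 1" "cmod b = 1"
  shows "scalar_measure E (a *\<^sub>C P B \<psi> + b *\<^sub>C P (- B) \<psi>) = scalar_measure E \<psi>"
proof (rule measure_eqI)
  have nB: "- B \<in> sets borel" using B by (rule borel_comp)
  let ?\<xi> = "a *\<^sub>C P B \<psi> + b *\<^sub>C P (- B) \<psi>"
  have \<xi>: "?\<xi> \<in> supported I"
    using subspace_supported[of I] P_supported B nB \<psi> by (simp add: ell2_vs.subspace_def)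
  fix C :: "real set" assume "C \<in> sets (scalar_measure E ?\<xi>)"
  then have C: "C \<in> sets borel" by simp
  have CB: "C \<inter> B \<in> sets borel" "C \<inter> - B \<in> sets borel" using B nB C by auto
  have "cinner (P (C \<inter> B) \<psi>) (P (C \<inter> - B) \<psi>) = cinner \<psi> (P (C \<inter> B) (P (C \<inter> - B) \<psi>))"
    using CB \<psi> by (simp add: P_symmetric P_supported)
  also have "P (C \<inter> B) (P (C \<inter> - B) \<psi>) = 0"
    using CB \<psi> by (intro P_disjoint) auto
  finally have "cinner (P (C \<inter> B) \<psi>) (P (C \<inter> - B) \<psi>) = 0" by simp
  then have "(norm (P C ?\<xi>))\<^sup>2 = (norm (P (C \<inter> B) \<psi>))\<^sup>2 + (norm (P (C \<inter> - B) \<psi>))\<^sup>2"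
    unfolding P_combination[OF C B \<psi>] using ab by (rule norm_orthogonal_phases)
  also have "\<dots> = (norm (P (C \<inter> B \<union> C \<inter> - B) \<psi>))\<^sup>2"
    using CB \<psi> by (intro norm_P_Un[symmetric]) auto
  also have "C \<inter> B \<union> C \<inter> - B = C" by auto
  finally show "emeasure (scalar_measure E ?\<xi>) C = emeasure (scalar_measure E \<psi>) C"
    using C \<xi> \<psi> by (simp add: emeasure_scalar_measure)
qed simp

section \<open>Spectral integrals: invariance of the domain, cross terms and uniqueness\<close>

context
  fixes g :: "real \<Rightarrow> complex" and T :: "'a operator"
  assumes T: "is_spectral_integral (supported I) E g T"
begin

lemma subspace_dom: "ell2_vs.subspace (dom T)"
  and dom_supported: "dom T \<subseteq> supported I"
  and T_add: "\<psi> \<in> dom T \<Longrightarrow> \<phi> \<in> dom T \<Longrightarrow> the (T (\<psi> + \<phi>)) = the (T \<psi>) + the (T \<phi>)"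
  and T_scale: "\<psi> \<in> dom T \<Longrightarrow> the (T (c *\<^sub>C \<psi>)) = c *\<^sub>C the (T \<psi>)"
proof -
  have "linear_operator (supported I) T" using T by (simp add: is_spectral_integral_def)
  then show "ell2_vs.subspace (dom T)" "dom T \<subseteq> supported I"
    "\<psi> \<in> dom T \<Longrightarrow> \<phi> \<in> dom T \<Longrightarrow> the (T (\<psi> + \<phi>)) = the (T \<psi>) + the (T \<phi>)"
    "\<psi> \<in> dom T \<Longrightarrow> the (T (c *\<^sub>C \<psi>)) = c *\<^sub>C the (T \<psi>)"
    by (simp_all add: linear_operator_def)
qed

text \<open>Within \<open>supported I\<close>, membership in the domain depends on the scalar
  measure alone, which the phases leave unchanged.\<close>

lemma phases_in_dom:
  assumes "B \<in> sets borel" "\<psi> \<in> dom T" "cmod a = 1" "cmod b = 1"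
  shows "a *\<^sub>C P B \<psi> + b *\<^sub>C P (- B) \<psi> \<in> dom T"
proof -
  have \<psi>: "\<psi> \<in> supported I" using assms dom_supported by blast
  have "- B \<in> sets borel" using assms(1) by (rule borel_comp)
  then have "a *\<^sub>C P B \<psi> + b *\<^sub>C P (- B) \<psi> \<in> supported I"
    using subspace_supported[of I] P_supported assms(1) \<psi> by (simp add: ell2_vs.subspace_def)
  then show ?thesis
    using T assms(2) scalar_measure_phases[OF assms(1) \<psi> assms(3,4)]
    by (simp add: is_spectral_integral_def)
qed

text \<open>\<open>P B \<psi>\<close> is the average of the combinations with phases
  \<open>(1, 1)\<close> and \<open>(1, -1)\<close>, and the domain is a subspace.\<close>

lemma P_in_dom:
  assumes "B \<in> sets borel" "\<psi> \<in> dom T"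
  shows "P B \<psi> \<in> dom T"
proof -
  have "(1/2) *\<^sub>C ((1 *\<^sub>C P B \<psi> + 1 *\<^sub>C P (- B) \<psi>) + (1 *\<^sub>C P B \<psi> + (-1) *\<^sub>C P (- B) \<psi>)) \<in> dom T"
    by (intro ell2_vs.subspace_scale ell2_vs.subspace_add subspace_dom phases_in_dom assms) simp_all
  moreover have "(1/2) *\<^sub>C ((1 *\<^sub>C P B \<psi> + 1 *\<^sub>C P (- B) \<psi>) + (1 *\<^sub>C P B \<psi> + (-1) *\<^sub>C P (- B) \<psi>)) = P B \<psi>"
    by (rule coord_eqI) simp
  ultimately show ?thesis by simp
qed

text \<open>The scalar measure, and hence the quadratic form of \<open>T\<close>, does not see the relative phase of
  the two components; the phases \<open>1\<close>, \<open>-1\<close> and \<open>\<i>\<close> suffice to isolate the cross term.\<close>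

lemma cross_term_zero:
  assumes B: "B \<in> sets borel" and \<psi>: "\<psi> \<in> dom T"
  shows "cinner (P B \<psi>) (the (T (P (- B) \<psi>))) = 0"
proof -
  define u v where "u = P B \<psi>" and "v = P (- B) \<psi>"
  have d: "u \<in> dom T" "v \<in> dom T"
    unfolding u_def v_def by (rule P_in_dom[OF B \<psi>], rule P_in_dom[OF borel_comp[OF B] \<psi>])
  have sc: "c *\<^sub>C \<phi> \<in> dom T" if "\<phi> \<in> dom T" for c \<phi>
    using that subspace_dom by (simp add: ell2_vs.subspace_def)
  have const: "cinner (a *\<^sub>C u + b *\<^sub>C v) (the (T (a *\<^sub>C u + b *\<^sub>C v)))
      = (LINT x|scalar_measure E \<psi>. g x)" if "cmod a = 1" "cmod b = 1" for a b
    using T phases_in_dom[OF B \<psi> that] scalar_measure_phases[OF B _ that, of \<psi>] \<psi> dom_supported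
    unfolding is_spectral_integral_def u_def v_def by auto
  have expand: "cinner (a *\<^sub>C u + b *\<^sub>C v) (the (T (a *\<^sub>C u + b *\<^sub>C v)))
      = cnj a * a * cinner u (the (T u)) + cnj a * b * cinner u (the (T v))
        + cnj b * a * cinner v (the (T u)) + cnj b * b * cinner v (the (T v))" for a b
    by (simp add: T_add T_scale sc d cinner_add_left cinner_add_right cinner_scaleC_left
        cinner_scaleC_right algebra_simps)
  \<comment> \<open>The first two equations give \<beta> + \<gamma> = 0 and \<alpha> + \<delta> = K;
    the third then gives \<beta> = \<gamma>.\<close>
  have solve: "\<beta> = 0" if "\<alpha> + \<beta> + \<gamma> + \<delta> = K" "\<alpha> - \<beta> - \<gamma> + \<delta> = K" "\<alpha> + \<i> * \<beta> - \<i> * \<gamma> + \<delta> = K"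
    for \<alpha> \<beta> \<gamma> \<delta> K :: complex
    using that by (simp add: complex_eq_iff)
  have "cinner u (the (T v)) = 0"
    by (rule solve[OF _ _ _, where \<alpha> = "cinner u (the (T u))" and \<gamma> = "cinner v (the (T u))"
          and \<delta> = "cinner v (the (T v))" and K = "LINT x|scalar_measure E \<psi>. g x"])
      (use const[of 1 1, unfolded expand] const[of 1 "-1", unfolded expand]
          const[of 1 \<i>, unfolded expand] in simp_all)
  then show ?thesis by (simp add: u_def v_def)
qed

text \<open>The difference of the two operators has vanishing quadratic form on the common domain.
  Complex polarization removes all its matrix elements there, and testing on kets removes every
  coordinate.\<close>

lemma spectral_integral_unique:
  assumes T': "is_spectral_integral (supported I) E g T'" and kets: "ket ` I \<subseteq> dom T"
  shows "T = T'"
proof -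
  have dom: "dom T' = dom T" using T T' by (simp add: is_spectral_integral_def)
  have lin': "\<psi> \<in> dom T \<Longrightarrow> \<phi> \<in> dom T \<Longrightarrow> the (T' (\<psi> + \<phi>)) = the (T' \<psi>) + the (T' \<phi>)"
    "\<psi> \<in> dom T \<Longrightarrow> the (T' (c *\<^sub>C \<psi>)) = c *\<^sub>C the (T' \<psi>)" for \<psi> \<phi> c
    using T' unfolding is_spectral_integral_def linear_operator_def dom by simp_all
  define D where "D \<psi> = the (T \<psi>) - the (T' \<psi>)" for \<psi>
  have D_add: "D (\<psi> + \<phi>) = D \<psi> + D \<phi>" if "\<psi> \<in> dom T" "\<phi> \<in> dom T" for \<psi> \<phi>
    using that by (simp add: D_def T_add lin')
  have D_scale: "D (c *\<^sub>C \<psi>) = c *\<^sub>C D \<psi>" if "\<psi> \<in> dom T" for \<psi> c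
    using that by (simp add: D_def T_scale lin' ell2_vs.scale_right_diff_distrib)
  have Q: "cinner \<psi> (D \<psi>) = 0" if "\<psi> \<in> dom T" for \<psi>
    using that T T' dom by (simp add: is_spectral_integral_def D_def cinner_diff_right)
  have zero: "cinner \<phi> (D \<psi>) = 0" if \<psi>: "\<psi> \<in> dom T" and \<phi>: "\<phi> \<in> dom T" for \<psi> \<phi>
  proof -
    have sc: "c *\<^sub>C \<psi> \<in> dom T" "\<phi> + c *\<^sub>C \<psi> \<in> dom T" for c
      using \<psi> \<phi> subspace_dom by (simp_all add: ell2_vs.subspace_def)
    \<comment> \<open>Polarization: the form is expanded at
      \<open>\<phi> + c *\<^sub>C \<psi>\<close>; the values \<open>c = 1\<close> and
      \<open>c = \<i>\<close> separate the two mixed terms.\<close>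
    have *: "c * cinner \<phi> (D \<psi>) + cnj c * cinner \<psi> (D \<phi>) = 0" for c
      using Q[OF sc(2), of c] Q[OF \<psi>] Q[OF \<phi>]
      by (simp add: D_add D_scale sc \<psi> \<phi> cinner_add_left cinner_add_right cinner_scaleC_left
          cinner_scaleC_right add.commute)
    have "cinner \<psi> (D \<phi>) = - cinner \<phi> (D \<psi>)"
      using *[of 1] by (simp add: eq_neg_iff_add_eq_0 add.commute)
    then have "2 * \<i> * cinner \<phi> (D \<psi>) = 0" using *[of \<i>] by simp
    then show ?thesis by simp
  qed
  have "the (T \<psi>) = the (T' \<psi>)" if \<psi>: "\<psi> \<in> dom T" for \<psi>
  proof (rule supported_eqI)
    have "ran T \<subseteq> supported I" "ran T' \<subseteq> supported I"
      using T T' by (simp_all add: is_spectral_integral_def linear_operator_def)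
    moreover have "the (T \<psi>) \<in> ran T" "the (T' \<psi>) \<in> ran T'"
      using \<psi> \<psi>[folded dom] by (auto intro: ranI)
    ultimately show "the (T \<psi>) \<in> supported I" "the (T' \<psi>) \<in> supported I" by blast+
    fix n assume "n \<in> I"
    then have "ket n \<in> dom T" using kets by blast
    from zero[OF \<psi> this] show "coord (the (T \<psi>)) n = coord (the (T' \<psi>)) n"
      by (simp add: cinner_ket_left D_def)
  qed
  then show ?thesis using dom by (metis (no_types, lifting) domIff ext option.expand)
qed

end

text \<open>If \<open>\<phi>\<close> is the part of an eigenvector on one side of the eigenvalue \<open>l\<close>, then
  \<open>x - l\<close> has constant sign and integral zero with respect to the scalar measure of \<open>\<phi>\<close>.\<close>

lemma eigenvector_P_side:
  fixes l \<sigma> :: real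
  assumes A: "is_spectral_integral (supported I) E complex_of_real A"
    and ev: "A \<psi> = Some (complex_of_real l *\<^sub>C \<psi>)"
  shows "P {x. 0 < \<sigma> * (x - l)} \<psi> = 0"
proof -
  \<comment> \<open>The sign of \<sigma> selects the side of \<open>l\<close>, so one argument
    serves for both.\<close>
  define B where "B = {x. 0 < \<sigma> * (x - l)}"
  have B: "B \<in> sets borel" "- B \<in> sets borel"
    unfolding B_def by (auto intro!: borel_open borel_comp open_Collect_less continuous_intros)
  have \<psi>: "\<psi> \<in> dom A" "\<psi> \<in> supported I" using ev dom_supported[OF A] by auto
  define \<phi> where "\<phi> = P B \<psi>"
  have \<phi>: "\<phi> \<in> dom A" "\<phi> \<in> supported I"
    unfolding \<phi>_def using P_in_dom[OF A B(1) \<psi>(1)] P_supported[OF B(1) \<psi>(2)] .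
  let ?\<mu> = "scalar_measure E \<phi>"
  interpret finite_measure ?\<mu> by (rule finite_measure_scalar_measure[OF \<phi>(2)])
  \<comment> \<open>The eigenvalue equation is split along \<open>B\<close>; pairing with \<phi>
    then removes the second summand by \<open>cross_term_zero\<close>.\<close>
  have "complex_of_real l *\<^sub>C \<psi> = the (A \<phi>) + the (A (P (- B) \<psi>))"
    using T_add[OF A \<phi>(1) P_in_dom[OF A B(2) \<psi>(1)]] P_decomp[OF B(1) \<psi>(2)] ev
    by (simp add: \<phi>_def)
  then have "cinner \<phi> (the (A \<phi>)) = cinner \<phi> (complex_of_real l *\<^sub>C \<psi>)"
    using cross_term_zero[OF A B(1) \<psi>(1)] by (simp add: cinner_add_right \<phi>_def)
  also have "\<dots> = l * cinner \<psi> \<phi>"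
    using P_symmetric[OF B(1) \<psi>(2) \<psi>(2)] by (simp add: cinner_scaleC_right \<phi>_def)
  also have "cinner \<psi> \<phi> = complex_of_real ((norm \<phi>)\<^sup>2)"
    unfolding \<phi>_def by (rule cinner_P[OF B(1) \<psi>(2)])
  finally have "(LINT x|?\<mu>. complex_of_real x) = complex_of_real (l * (norm \<phi>)\<^sup>2)"
    using A \<phi>(1) by (simp add: is_spectral_integral_def)
  then have mean: "(LINT x|?\<mu>. x) = l * (norm \<phi>)\<^sup>2"
    unfolding integral_complex_of_real of_real_eq_iff .
  \<comment> \<open>Membership of \<phi> in the domain means that the identity is square integrable;
    for a finite measure this yields integrability.\<close>
  have "(\<integral>\<^sup>+x. ennreal ((cmod (complex_of_real x))\<^sup>2) \<partial>?\<mu>) < \<infinity>"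
    using A \<phi>(1) by (simp add: is_spectral_integral_def)
  then have "integrable ?\<mu> (\<lambda>x. x\<^sup>2)"
    by (simp add: integrable_iff_bounded)
  then have int: "integrable ?\<mu> (\<lambda>x. x)"
    by (rule square_integrable_imp_integrable[rotated]) simp
  have total: "measure ?\<mu> UNIV = (norm \<phi>)\<^sup>2"
    using emeasure_scalar_measure[of UNIV \<phi>] \<phi>(2) by (simp add: P_UNIV measure_def)
  have AE: "AE x in ?\<mu>. x \<in> B"
  proof (rule AE_I[of _ _ "- B"])
    have "P (- B) \<phi> = 0" unfolding \<phi>_def using B \<psi>(2) by (intro P_disjoint) auto
    then show "emeasure ?\<mu> (- B) = 0" using B \<phi>(2) by (simp add: emeasure_scalar_measure)
  qed (use B in auto)
  have int': "integrable ?\<mu> (\<lambda>x. \<sigma> * (x - l))" using int by simp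
  have "(LINT x|?\<mu>. \<sigma> * (x - l)) = 0"
    using int mean total by simp
  moreover have "AE x in ?\<mu>. 0 \<le> \<sigma> * (x - l)" using AE by eventually_elim (simp add: B_def)
  ultimately have "AE x in ?\<mu>. \<sigma> * (x - l) = 0"
    using integral_nonneg_eq_0_iff_AE[OF int'] by simp
  \<comment> \<open>The integrand vanishes almost everywhere but is strictly positive on
    \<open>B\<close>, which carries the measure. Hence the total mass, which is the squared norm of
    \<phi>, is 0.\<close>
  with AE have "AE x in ?\<mu>. False" by eventually_elim (simp add: B_def)
  then have "emeasure ?\<mu> UNIV = 0" using AE_iff_measurable[of UNIV ?\<mu> "\<lambda>_. False"] by simp
  then show ?thesis
    using emeasure_scalar_measure[of UNIV \<phi>] \<phi>(2) by (simp add: P_UNIV \<phi>_def B_def)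
qed

text \<open>The signs 1 and -1 in \<open>eigenvector_P_side\<close> remove both sides of
  \<open>l\<close>, so \<psi> is concentrated on \<open>{l}\<close> and only
  \<open>B \<inter> {l}\<close> matters.\<close>

lemma eigenvector_P:
  fixes l :: real
  assumes A: "is_spectral_integral (supported I) E complex_of_real A"
    and ev: "A \<psi> = Some (complex_of_real l *\<^sub>C \<psi>)" and B: "B \<in> sets borel"
  shows "P B \<psi> = of_bool (l \<in> B) *\<^sub>C \<psi>"
proof -
  have \<psi>: "\<psi> \<in> supported I" using ev dom_supported[OF A] by auto
  have "P ({x. 0 < 1 * (x - l)} \<union> {x. 0 < (-1) * (x - l)}) \<psi>
      = P {x. 0 < 1 * (x - l)} \<psi> + P {x. 0 < (-1) * (x - l)} \<psi>"
    by (rule P_Un[OF _ _ _ \<psi>]) auto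
  also have "\<dots> = 0" unfolding eigenvector_P_side[OF A ev] by simp
  also have "{x. 0 < 1 * (x - l)} \<union> {x. 0 < (-1) * (x - l)} = - {l}" by auto
  finally have single: "P {l} \<psi> = \<psi>" using P_decomp[of "{l}" \<psi>] \<psi> by simp
  then have "P B \<psi> = P (B \<inter> {l}) \<psi>" using P_Int[OF B _ \<psi>, of "{l}"] by simp
  then show ?thesis using single by (cases "l \<in> B") (simp_all add: P_empty[OF \<psi>])
qed

text \<open>Kets are eigenvectors, and symmetry of the projection expresses each coordinate of
  \<open>P B \<psi>\<close> through \<open>P B (ket n)\<close>.\<close>

lemma spectral_measure_of_diag_op_unique:
  assumes A: "is_spectral_integral (supported I) E complex_of_real (diag_op I (\<lambda>n. complex_of_real (s n)))"
    and B: "B \<in> sets borel"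
  shows "E B = diag_pvm I s B"
proof (rule ext)
  fix \<psi>
  show "E B \<psi> = diag_pvm I s B \<psi>"
  proof (cases "\<psi> \<in> supported I")
    case True
    have "coord (P B \<psi>) n = of_bool (s n \<in> B) * coord \<psi> n" for n
    proof (cases "n \<in> I")
      case n: True
      have "coord (P B \<psi>) n = cinner (P B (ket n)) \<psi>"
        using P_symmetric[OF B True, of "ket n"] n by (simp add: cinner_ket_left)
      also have "P B (ket n) = of_bool (s n \<in> B) *\<^sub>C ket n"
        using n by (intro eigenvector_P[OF A _ B] diag_op_ket)
      finally show ?thesis by (simp add: cinner_scaleC_left cinner_ket_left)
    next
      case False
      then show ?thesis using True P_supported[OF B True] by (simp add: supported_def)
    qed
    then have "diag_pvm I s B \<psi> = Some (P B \<psi>)"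
      unfolding diag_pvm_def diag_op_eq_Some_iff using True by simp
    with E_eq[OF B True] show ?thesis by metis
  next
    case False
    then have "\<psi> \<notin> dom (E B)" "\<psi> \<notin> dom (diag_pvm I s B)"
      unfolding dom_E[OF B] dom_diag_pvm by simp_all
    then show ?thesis by (simp add: domIff)
  qed
qed

end

section \<open>Borel calculus and evolution of diagonal operators\<close>

lemma is_spectral_integral_cong:
  assumes "\<And>B. B \<in> sets borel \<Longrightarrow> E B = E' B"
  shows "is_spectral_integral H E g T \<longleftrightarrow> is_spectral_integral H E' g T"
  unfolding is_spectral_integral_def using scalar_measure_cong[of E _ E'] assms by simp

text \<open>The chosen spectral measure agrees with \<open>diag_pvm I s\<close> on Borel sets, so
  the diagonal operator is a spectral integral for it; by uniqueness it is the value of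
  \<open>THE\<close>.\<close>

lemma borel_calculus_diag_op:
  fixes I :: "'a set" and s :: "'a \<Rightarrow> real" and g :: "real \<Rightarrow> complex"
  defines "A \<equiv> diag_op I (\<lambda>n. complex_of_real (s n))"
  assumes g: "g \<in> borel_measurable
    (restrict_space borel {x. complex_of_real x \<in> spectrum (supported I) A})"
  shows "borel_calculus (supported I) A g = diag_op I (\<lambda>n. g (s n))"
proof -
  let ?\<Sigma> = "{x. complex_of_real x \<in> spectrum (supported I) A}"
  define G where "G = (\<lambda>x. if complex_of_real x \<in> spectrum (supported I) A then g x else 0)"
  have spec: "spectrum (supported I) A = closure ((\<lambda>n. complex_of_real (s n)) ` I)"
    unfolding A_def by (rule spectrum_diag_op)
  \<comment> \<open>The spectrum is closed, hence Borel, so extending \<open>g\<close> by 0 off the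
    spectrum gives a Borel function on the whole line.\<close>
  have "closed (complex_of_real -` closure ((\<lambda>n. complex_of_real (s n)) ` I))"
    by (intro continuous_closed_vimage closed_closure continuous_intros)
  then have "?\<Sigma> \<in> sets borel"
    unfolding spec vimage_def by (rule borel_closed)
  then have "(\<lambda>x. indicator ?\<Sigma> x *\<^sub>R g x) \<in> borel_measurable borel"
    using g by (subst (asm) borel_measurable_restrict_space_iff) simp_all
  also have "(\<lambda>x. indicator ?\<Sigma> x *\<^sub>R g x) = G"
    by (auto simp: G_def)
  finally have G: "G \<in> borel_measurable borel" .
  \<comment> \<open>Every entry \<open>s n\<close> lies in the spectrum, so the cutoff in
    \<open>G\<close> changes no entry.\<close>
  have eq: "diag_op I (\<lambda>n. G (s n)) = diag_op I (\<lambda>n. g (s n))"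
  proof (rule diag_op_cong)
    fix n assume "n \<in> I"
    then have "complex_of_real (s n) \<in> spectrum (supported I) A"
      unfolding spec by (intro subsetD[OF closure_subset] imageI)
    then show "G (s n) = g (s n)" by (simp add: G_def)
  qed
  define E where "E = (SOME E. spectral_measure_of (supported I) A E)"
  \<comment> \<open>Existence, witnessed by \<open>diag_pvm I s\<close>, gives the choice by
    \<open>SOME\<close> its defining property.\<close>
  have "spectral_measure_of (supported I) A E"
    unfolding E_def A_def by (rule someI[of _ "diag_pvm I s"]) (rule spectral_measure_of_diag_op)
  then interpret E: spectral_family I E
    by unfold_locales (simp add: spectral_measure_of_def)
  have "is_spectral_integral (supported I) E complex_of_real A"
    using \<open>spectral_measure_of (supported I) A E\<close> by (simp add: spectral_measure_of_def)
  then have E_eq: "E B = diag_pvm I s B" if "B \<in> sets borel" for B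
    unfolding A_def using that by (rule E.spectral_measure_of_diag_op_unique)
  have integral: "is_spectral_integral (supported I) E G (diag_op I (\<lambda>n. G (s n)))"
    by (rule iffD2[OF is_spectral_integral_cong is_spectral_integral_diag_pvm[OF G]]) (rule E_eq)
  have "(THE T. is_spectral_integral (supported I) E G T) = diag_op I (\<lambda>n. G (s n))"
  proof (rule the_equality, rule integral)
    fix T assume T: "is_spectral_integral (supported I) E G T"
    have "ket ` I \<subseteq> dom (diag_op I (\<lambda>n. G (s n)))"
      by (simp add: image_subset_iff ket_in_dom_diag_op)
    then show "T = diag_op I (\<lambda>n. G (s n))"
      by (rule E.spectral_integral_unique[OF integral T, symmetric])
  qed
  then show ?thesis
    unfolding borel_calculus_def E_def[symmetric] G_def[symmetric] eq .
qed

section \<open>The propagator and the Heisenberg evolution\<close>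

lemma propagator_diag_op:
  fixes a :: "'a \<Rightarrow> real" and hbar :: real
  shows "propagator (supported I) hbar (diag_op I (\<lambda>n. complex_of_real (a n))) t =
    diag_op I (\<lambda>n. exp (\<i> / complex_of_real hbar * complex_of_real (a n) * complex_of_real t))"
  unfolding propagator_def
proof (rule borel_calculus_diag_op, rule measurable_restrict_space1)
  show "(\<lambda>x. exp (\<i> / complex_of_real hbar * complex_of_real x * complex_of_real t))
      \<in> borel_measurable borel"
    by (intro borel_measurable_continuous_onI continuous_intros)
qed

lemma bounded_operator_scale:
  assumes "bounded_operator H X" "\<psi> \<in> H"
  shows "X (c *\<^sub>C \<psi>) = Some (c *\<^sub>C the (X \<psi>))"
proof -
  have X: "linear_operator H X" "dom X = H" using assms by (simp_all add: bounded_operator_def)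
  then have "ell2_vs.subspace H" by (simp add: linear_operator_def)
  then have "c *\<^sub>C \<psi> \<in> dom X" using assms(2) X(2) ell2_vs.subspace_scale by metis
  then obtain \<phi> where "X (c *\<^sub>C \<psi>) = Some \<phi>" by blast
  moreover have "the (X (c *\<^sub>C \<psi>)) = c *\<^sub>C the (X \<psi>)"
    using X assms(2) by (simp add: linear_operator_def)
  ultimately show ?thesis by simp
qed

text \<open>The inner propagator turns \<open>ket m\<close> into a multiple of itself, linearity
  takes the factor through \<open>X\<close>, and the outer propagator multiplies
  coordinates.\<close>

lemma heisenberg_evolution_diag_op_ket:
  fixes a :: "'a \<Rightarrow> real" and hbar t :: real
  defines "u \<equiv> \<lambda>t n. exp (\<i> / complex_of_real hbar * complex_of_real (a n) * complex_of_real t)"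
  assumes X: "bounded_operator (supported I) X" and m: "m \<in> I"
  obtains \<phi> where
    "heisenberg_evolution (supported I) hbar (diag_op I (\<lambda>n. complex_of_real (a n))) X t (ket m) = Some \<phi>"
    "\<And>n. coord \<phi> n = u t n * (u (- t) m * coord (the (X (ket m))) n)"
proof -
  let ?\<xi> = "u (- t) m *\<^sub>C the (X (ket m))"
  have km: "ket m \<in> supported I" using m by simp
  have Xk: "X (u (- t) m *\<^sub>C ket m) = Some ?\<xi>"
    by (rule bounded_operator_scale[OF X km])
  \<comment> \<open>The exponents are purely imaginary, so the entries have modulus 1 and the
    operator is defined everywhere.\<close>
  have U: "bounded_operator (supported I) (diag_op I (u t))" for t
    by (rule bounded_operator_diag_op[of _ _ 1]) (simp add: u_def)
  have "ran X \<subseteq> supported I" using X by (simp add: bounded_operator_def linear_operator_def)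
  with Xk have "?\<xi> \<in> supported I" by (blast intro: ranI)
  then have "?\<xi> \<in> dom (diag_op I (u t))" using U[of t] by (simp add: bounded_operator_def)
  then obtain \<phi> where \<phi>: "diag_op I (u t) ?\<xi> = Some \<phi>" by blast
  have propagator: "propagator (supported I) hbar (diag_op I (\<lambda>n. complex_of_real (a n))) t = diag_op I (u t)" for t
    unfolding u_def by (rule propagator_diag_op)
  show thesis
  proof
    show "heisenberg_evolution (supported I) hbar (diag_op I (\<lambda>n. complex_of_real (a n))) X t (ket m) = Some \<phi>"
      unfolding heisenberg_evolution_def propagator map_comp_def by (simp add: diag_op_ket[OF m] Xk \<phi>)
    show "coord \<phi> n = u t n * (u (- t) m * coord (the (X (ket m))) n)" for n
      using \<phi> by (simp add: diag_op_eq_Some_iff)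
  qed
qed

theorem theorem2p11:
  fixes I :: "int set"
    and s :: "int \<Rightarrow> real"
    and S X :: "int operator"
    and f :: "real \<Rightarrow> real"
    and hbar :: real
  defines "Hplus \<equiv> closure (ell2_vs.span (ket ` I))"
  assumes S_selfadjoint: "self_adjoint Hplus S"
    and S_diagonal: "\<forall>n\<in>I. S (ket n) = Some (complex_of_real (s n) *\<^sub>C ket n)"
    and s_pos: "\<forall>n\<in>I. s n > 0"
    and f_borel: "f \<in> borel_measurable
                    (restrict_space borel {x. complex_of_real x \<in> spectrum Hplus S})"
    and hbar_pos: "hbar > 0"
    and X_op: "bounded_operator Hplus X \<or> hilbert_schmidt Hplus X"
  defines "Ham \<equiv> scale_operator (complex_of_real hbar)
                   (borel_calculus Hplus S (\<lambda>x. complex_of_real (f x)))"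
    and "\<omega> \<equiv> (\<lambda>n m. f (s n) - f (s m))"
    and "A \<equiv> (\<lambda>n m. matrix_element n X m)"
  shows "(\<forall>t :: real. \<forall>n\<in>I. \<forall>m\<in>I.
            ket m \<in> dom (heisenberg_evolution Hplus hbar Ham X t) \<and>
            matrix_element n (heisenberg_evolution Hplus hbar Ham X t) m =
              A n m * exp (\<i> * complex_of_real (\<omega> n m) * complex_of_real t)) \<and>
         (\<forall>n\<in>I. \<forall>m\<in>I. \<forall>k\<in>I.
            \<omega> n m + \<omega> m k = \<omega> n k \<and> \<omega> n n = 0 \<and> \<omega> n m = - \<omega> m n)"
proof -
  have H: "Hplus = supported I" unfolding Hplus_def by (rule closure_span_ket)
  have X: "bounded_operator (supported I) X"
    using X_op by (auto simp: H hilbert_schmidt_def)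
  have S: "S = diag_op I (\<lambda>n. complex_of_real (s n))"
    using S_selfadjoint S_diagonal unfolding H by (intro self_adjoint_diagonal_eq_diag_op) auto
  have "borel_calculus (supported I) S (\<lambda>x. complex_of_real (f x)) = diag_op I (\<lambda>n. complex_of_real (f (s n)))"
    unfolding S using f_borel unfolding H S by (intro borel_calculus_diag_op) measurable
  \<comment> \<open>Positivity of \<open>hbar\<close> provides the nonzero factor required by
    \<open>scale_operator_diag_op\<close>.\<close>
  then have Ham: "Ham = diag_op I (\<lambda>n. complex_of_real (hbar * f (s n)))"
    unfolding Ham_def H using hbar_pos by (simp add: scale_operator_diag_op)
  have "ket m \<in> dom (heisenberg_evolution Hplus hbar Ham X t) \<and>
      matrix_element n (heisenberg_evolution Hplus hbar Ham X t) m =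
        A n m * exp (\<i> * complex_of_real (\<omega> n m) * complex_of_real t)"
    if m: "m \<in> I" for t n m
  proof -
    obtain \<phi> where \<phi>: "heisenberg_evolution Hplus hbar Ham X t (ket m) = Some \<phi>"
      "coord \<phi> n = exp (\<i> / complex_of_real hbar * complex_of_real (hbar * f (s n)) * complex_of_real t) *
        (exp (\<i> / complex_of_real hbar * complex_of_real (hbar * f (s m)) * complex_of_real (- t)) *
          coord (the (X (ket m))) n)"
      unfolding H Ham by (rule heisenberg_evolution_diag_op_ket[OF X m, where hbar = hbar
          and a = "\<lambda>n. hbar * f (s n)" and t = t]) blast
    \<comment> \<open>\<open>hbar\<close> cancels in each exponent, and the opposite signs of
      \<open>t\<close> produce the difference of the two frequencies.\<close>
    have phase: "exp (\<i> / complex_of_real hbar * complex_of_real (hbar * f (s n)) * complex_of_real t) *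
        exp (\<i> / complex_of_real hbar * complex_of_real (hbar * f (s m)) * complex_of_real (- t)) =
        exp (\<i> * complex_of_real (\<omega> n m) * complex_of_real t)"
      using hbar_pos by (simp add: \<omega>_def exp_add[symmetric] algebra_simps)
    have "coord \<phi> n = coord (the (X (ket m))) n * exp (\<i> * complex_of_real (\<omega> n m) * complex_of_real t)"
      unfolding phase[symmetric] \<phi>(2) by (simp only: mult_ac)
    then show ?thesis
      using \<phi>(1) by (simp add: A_def matrix_element_def cinner_ket_left domI)
  qed
  then show ?thesis by (simp add: \<omega>_def)
qed

end
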